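(* Let $f^1,\dots,f^n$ be twice differentiable with $m_f I\preceq \nabla^2 f^i(\xi)\preceq M_f I$ for all $\xi\in\mathbb{R}^d$ and $i\in[n]$, where $0<m_f\le M_f$, and let $g$ be proper, closed and convex. Let $(x_t,z_t,y_t)_{t\ge 0}$ be generated by the DN-ADMM($K$) iteration given in the context, with $y_0=0$. Let $\lambda_{\min}$ denote the smallest positive eigenvalue of $B^\top B$, and let $$\gamma = 2M_f+\frac{1}{\mu}+\Big(M_f+\epsilon+\frac{1+2(n-1)}{\mu}\Big)\left(\frac{2(n-1)}{\mu(m_f+\epsilon)+2(n-1)}\right)^{K+1}.$$ Choose $$\epsilon>\left[2M_f+\frac{m_f+2M_f(n-1)}{\mu m_f}\right]^2\frac{m_f+M_f}{2m_fM_f},$$ and let $\beta>1$, $\eta>1$ and $\zeta\in\big(\frac{m_f+M_f}{2m_fM_f},\frac{\epsilon}{\gamma^2}\big)$ be arbitrary constants. Let $$v_t=\begin{bmatrix}x_t\\ y_t\end{bmatrix},\qquad v_\star=\begin{bmatrix}x_\star\\ y_\star\end{bmatrix},\qquad \mathcal{H}=\begin{bmatrix}\epsilon I&0\\0&\mu I\end{bmatrix},\qquad \|v\|_{\mathcal H}^2=v^\top\mathcal{H}v,$$ where $x_\star$ is the primal optimal solution and $y_\star$ is the unique dual optimal solution in the column space of $B^\top$. Then the sequence $\{\|v_t-v_\star\|_{\mathcal H}^2\}_{t\in\mathbb{N}}$ converges linearly: for all $t$, $$\|v_{t+1}-v_\star\|_{\mathcal H}^2\le\frac{1}{1+\delta}\|v_t-v_\star\|_{\mathcal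 H}^2,$$ where $$\delta=\min\left\{\frac{2m_fM_f}{\epsilon(m_f+M_f)}-\frac{1}{\epsilon\zeta},\ \frac{(\epsilon-\zeta\gamma^2)\lambda_{\min}(\beta-1)(\eta-1)}{\mu\beta[\epsilon^2(\eta-1)+\eta\gamma^2(\beta-1)]},\ \frac{2\lambda_{\min}}{(m_f+M_f)\mu\beta\eta}\right\}.$$
   Context: Setting. $\mathcal{G}$ is an undirected connected graph with vertices indexed by $[n]=\{1,\dots,n\}$ and $m$ edges; $\mathcal{A}\in\mathbb{R}^{n\times m}$ is its signed incidence matrix (each edge given an arbitrary orientation), and $L=\mathcal{A}\mathcal{A}^\top$ is the graph Laplacian. $L_{\mathrm{dia}}$ is the diagonal part of $L$ (vertex degrees) and $L_{\mathrm{off}}=L-L_{\mathrm{dia}}$ the off-diagonal part (entries $-1$ for edges, $0$ otherwise). Fix $l\in[n]$, let $e^l\in\mathbb{R}^n$ be the $l$-th coordinate vector, and set $A=\mathcal{A}\otimes I_d$, $E^l=e^l\otimes I_d$, $B=[A,E^l]\in\mathbb{R}^{nd\times(m+1)d}$. Functions: $f^i:\mathbb{R}^d\to\mathbb{R}$ for $i\in[n]$; $F(x)=\sum_{i=1}^n f^i(x^i)$ for $x=[(x^1)^\top,\dots,(x^n)^\top]^\top\in\mathbb{R}^{nd}$; $g:\mathbb{R}^d\to\mathbb{R}\cup\{+\infty\}$, and $G(z)=g(\hat z)$ for $z=[0,\dots,0,\hat z^\top]^\top\in\mathbb{R}^{(m+1)d}$ (all blocks zero but the last, which is $\hat z\in\mathbb{R}^d$).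 The problem is: minimize $F(x)+G(z)$ over $x$ and such $z$ subject to $B^\top x=z$. Optimality. For $y\in\mathbb{R}^{(m+1)d}$, $y^{m+1}\in\mathbb{R}^d$ denotes its last block. Primal/dual optimal solutions $(x_\star,z_\star,y_\star)$, with $z_\star=[0,\dots,0,\hat z_\star^\top]^\top$, are those satisfying the KKT conditions: $\nabla F(x_\star)+By_\star=0$; $y_\star^{m+1}\in\partial g(\hat z_\star)$; $B^\top x_\star-z_\star=0$. A dual optimal solution is such a $y_\star$. There is exactly one dual optimal solution in the column space of $B^\top$. Proximal operator: $\mathbf{prox}_{\mu g}(v)=\mathrm{argmin}_z\{g(z)+\frac{1}{2\mu}\|v-z\|^2\}$. DN-ADMM($K$) iteration. Parameters $\mu>0$, $\epsilon>0$, integer $K\ge 0$. Define $$D_t=\nabla^2F(x_t)+\tfrac1\mu(e^l(e^l)^\top)\otimes I_d+\tfrac2\mu L_{\mathrm{dia}}\otimes I_d+\epsilon I_{nd},\qquad N=\tfrac1\mu(L_{\mathrm{dia}}-L_{\mathrm{off}})\otimes I_d,$$ $$\hat H_t^{-1}(K)=D_t^{-1/2}\sum_{i=0}^K\big(D_t^{-1/2}ND_t^{-1/2}\big)^iD_t^{-1/2}.$$ For $t\ge 0$, $$\hat\theta_{t+1}=\mathbf{prox}_{\mu g}(x_t^l+\mu y_t^{m+1}),$$ $$x_{t+1}=x_t-\hat H_t^{-1}(K)\big[\nabla F(x_t)+\tfrac1\mu B(B^\top x_t-\theta_{t+1})+By_t\big],$$ $$\hat z_{t+1}=\mathbf{prox}_{\mu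 g}(x_{t+1}^l+\mu y_t^{m+1}),$$ $$y_{t+1}=y_t+\tfrac1\mu(B^\top x_{t+1}-z_{t+1}),$$ where $\theta_{t+1},z_{t+1}\in\mathbb{R}^{(m+1)d}$ are zero except for their last blocks, equal to $\hat\theta_{t+1}$ and $\hat z_{t+1}$ respectively. *)

theory Defs
  imports "HOL-Analysis.Analysis"
begin

section \<open>Matrices\<close>

definition kron :: "real^'a::finite^'b::finite \<Rightarrow> real^'c::finite^'d::finite \<Rightarrow> real^('a \<times> 'c)^('b \<times> 'd)" (infixl "\<otimes>" 75)
  where "A \<otimes> C = (\<chi> i j. A $ fst i $ fst j * C $ snd i $ snd j)"

text \<open>The type class instance of \<open>*\<close> on vectors is componentwise, so \<open>^\<close> is not the
  matrix power.\<close>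

primrec mat_pow :: "real^'a^'a \<Rightarrow> nat \<Rightarrow> real^'a^'a"
  where "mat_pow A 0 = mat 1"
  | "mat_pow A (Suc k) = A ** mat_pow A k"

definition psd :: "real^'a^'a \<Rightarrow> bool"
  where "psd A \<longleftrightarrow> transpose A = A \<and> (\<forall>v. 0 \<le> v \<bullet> (A *v v))"

definition loewner_le :: "real^'a^'a \<Rightarrow> real^'a^'a \<Rightarrow> bool" (infix "\<preceq>" 50)
  where "A \<preceq> C \<longleftrightarrow> psd (C - A)"

definition psd_sqrt :: "real^'a^'a \<Rightarrow> real^'a^'a"
  where "psd_sqrt A = (THE S. psd S \<and> S ** S = A)"

definition inv_sqrt :: "real^'a^'a \<Rightarrow> real^'a^'a"
  where "inv_sqrt A = matrix_inv (psd_sqrt A)"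

definition is_eigenvalue :: "real^'a^'a \<Rightarrow> real \<Rightarrow> bool"
  where "is_eigenvalue A c \<longleftrightarrow> (\<exists>v. v \<noteq> 0 \<and> A *v v = c *\<^sub>R v)"

definition least_pos_eigenvalue :: "real^'a^'a \<Rightarrow> real"
  where "least_pos_eigenvalue A = Min {c. 0 < c \<and> is_eigenvalue A c}"


section \<open>Differential calculus\<close>

definition gradient :: "('a::real_inner \<Rightarrow> real) \<Rightarrow> 'a \<Rightarrow> 'a"
  where "gradient f x = (THE D. GDERIV f x :> D)"

definition twice_differentiable :: "('a::real_inner \<Rightarrow> real) \<Rightarrow> bool"
  where "twice_differentiable f \<longleftrightarrow>
    (\<forall>x. f differentiable (at x)) \<and> (\<forall>x. gradient f differentiable (at x))"

definition hessian :: "(real^'a \<Rightarrow> real) \<Rightarrow> real^'a \<Rightarrow> real^'a^'a"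
  where "hessian f x = matrix (frechet_derivative (gradient f) (at x))"


section \<open>Extended-valued convex functions\<close>

definition proper :: "('a \<Rightarrow> ereal) \<Rightarrow> bool"
  where "proper g \<longleftrightarrow> (\<forall>x. g x \<noteq> -\<infinity>) \<and> (\<exists>x. g x \<noteq> \<infinity>)"

definition ext_epigraph :: "('a \<Rightarrow> ereal) \<Rightarrow> ('a \<times> real) set"
  where "ext_epigraph g = {(x, r). g x \<le> ereal r}"

definition closed_fun :: "('a::topological_space \<Rightarrow> ereal) \<Rightarrow> bool"
  where "closed_fun g \<longleftrightarrow> closed (ext_epigraph g)"

definition convex_fun :: "('a::real_vector \<Rightarrow> ereal) \<Rightarrow> bool"
  where "convex_fun g \<longleftrightarrow> convex (ext_epigraph g)"

definition subdifferential :: "('a::real_inner \<Rightarrow> ereal) \<Rightarrow> 'a \<Rightarrow> 'a set"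
  where "subdifferential g x = {s. \<forall>w. g x + ereal (s \<bullet> (w - x)) \<le> g w}"

definition prox :: "real \<Rightarrow> ('a::real_inner \<Rightarrow> ereal) \<Rightarrow> 'a \<Rightarrow> 'a"
  where "prox \<mu> g v = (ARG_MIN (\<lambda>z. g z + ereal (1 / (2 * \<mu>) * (norm (v - z))\<^sup>2)) z. True)"


section \<open>Graphs\<close>

text \<open>The vertices are the elements of the finite type \<open>'n\<close>, so that \<open>n = CARD('n)\<close>. The finite
  type \<open>'b\<close> indexes the \<open>m + 1\<close> blocks of the dual variable: a distinguished element \<open>\<omega>\<close> is the
  index of the last block, and the remaining elements number the \<open>m\<close> edges. In contrast to a
  type of edges, which would have to be nonempty, this includes the graph with one vertex and
  no edge.\<close>

definition simple_graph :: "'n set set \<Rightarrow> bool"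
  where "simple_graph E \<longleftrightarrow> (\<forall>e\<in>E. card e = 2)"

definition connected_graph :: "'n set set \<Rightarrow> bool"
  where "connected_graph E \<longleftrightarrow> (\<forall>u v. (u, v) \<in> {(a, c). {a, c} \<in> E}\<^sup>*)"

text \<open>Edge \<open>e \<noteq> \<omega>\<close> is oriented from \<open>src e\<close> to \<open>dst e\<close>; the values of \<open>src\<close> and \<open>dst\<close> at \<open>\<omega>\<close>
  are irrelevant.\<close>

definition edge_numbering :: "'n set set \<Rightarrow> 'b \<Rightarrow> ('b \<Rightarrow> 'n) \<Rightarrow> ('b \<Rightarrow> 'n) \<Rightarrow> bool"
  where "edge_numbering E \<omega> src dst \<longleftrightarrow> bij_betw (\<lambda>e. {src e, dst e}) (- {\<omega>}) E"

definition incidence :: "('b \<Rightarrow> 'n) \<Rightarrow> ('b \<Rightarrow> 'n) \<Rightarrow> 'n \<Rightarrow> 'b \<Rightarrow> real"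
  where "incidence src dst i e = (if i = src e then 1 else if i = dst e then - 1 else 0)"

definition laplacian ::
    "'b::finite \<Rightarrow> ('b \<Rightarrow> 'n::finite) \<Rightarrow> ('b \<Rightarrow> 'n) \<Rightarrow> real^'n^'n"
  where "laplacian \<omega> src dst =
    (\<chi> i j. \<Sum>e \<in> - {\<omega>}. incidence src dst i e * incidence src dst j e)"

definition diag_part :: "real^'a^'a \<Rightarrow> real^'a^'a"
  where "diag_part A = (\<chi> i j. if i = j then A $ i $ j else 0)"

definition off_part :: "real^'a^'a \<Rightarrow> real^'a^'a"
  where "off_part A = A - diag_part A"

text \<open>Vectors in \<open>nd\<close> (and \<open>(m + 1)d\<close>) dimensions are indexed by pairs of a block index and
  a coordinate. The matrix \<open>B = [\<A> \<otimes> I, e\<^sup>l \<otimes> I]\<close> is \<open>[\<A>, e\<^sup>l] \<otimes> I\<close>.\<close>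

definition B_mat ::
    "'b::finite \<Rightarrow> ('b \<Rightarrow> 'n::finite) \<Rightarrow> ('b \<Rightarrow> 'n) \<Rightarrow> 'n \<Rightarrow> real^('b \<times> 'd::finite)^('n \<times> 'd)"
  where "B_mat \<omega> src dst l =
    (\<chi> i e. if e = \<omega> then axis l 1 $ i else incidence src dst i e) \<otimes> (mat 1 :: real^'d^'d)"

definition block :: "'a::finite \<Rightarrow> real^('a \<times> 'd::finite) \<Rightarrow> real^'d"
  where "block i x = (\<chi> k. x $ (i, k))"

definition embed :: "'b::finite \<Rightarrow> real^'d::finite \<Rightarrow> real^('b \<times> 'd)"
  where "embed \<omega> w = (\<chi> p. if fst p = \<omega> then w $ snd p else 0)"


section \<open>The optimization problem\<close>

definition sep_sum :: "('n \<Rightarrow> real^'d \<Rightarrow> real) \<Rightarrow> real^('n::finite \<times> 'd::finite) \<Rightarrow> real"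
  where "sep_sum f x = (\<Sum>i\<in>UNIV. f i (block i x))"

definition KKT ::
    "(real^('n \<times> 'd) \<Rightarrow> real) \<Rightarrow> (real^'d \<Rightarrow> ereal) \<Rightarrow> 'b \<Rightarrow> real^('b \<times> 'd)^('n \<times> 'd)
      \<Rightarrow> real^('n::finite \<times> 'd::finite) \<Rightarrow> real^('b::finite \<times> 'd) \<Rightarrow> real^('b \<times> 'd) \<Rightarrow> bool"
  where "KKT F g \<omega> B x z y \<longleftrightarrow>
    gradient F x + B *v y = 0 \<and>
    (\<exists>w. z = embed \<omega> w \<and> block \<omega> y \<in> subdifferential g w) \<and>
    transpose B *v x - z = 0"


section \<open>The iteration\<close>

definition D_mat ::
    "(real^('n \<times> 'd) \<Rightarrow> real) \<Rightarrow> real^'n^'n \<Rightarrow> 'n \<Rightarrow> real \<Rightarrow> real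
      \<Rightarrow> real^('n::finite \<times> 'd::finite) \<Rightarrow> real^('n \<times> 'd)^('n \<times> 'd)"
  where "D_mat F L l \<mu> \<epsilon> x =
    hessian F x
    + (1 / \<mu>) *\<^sub>R ((\<chi> i j. axis l 1 $ i * axis l 1 $ j) \<otimes> (mat 1 :: real^'d^'d))
    + (2 / \<mu>) *\<^sub>R (diag_part L \<otimes> (mat 1 :: real^'d^'d))
    + mat \<epsilon>"

definition N_mat :: "real^'n^'n \<Rightarrow> real \<Rightarrow> real^('n::finite \<times> 'd::finite)^('n \<times> 'd)"
  where "N_mat L \<mu> = (1 / \<mu>) *\<^sub>R ((diag_part L - off_part L) \<otimes> (mat 1 :: real^'d^'d))"

definition H_inv :: "real^'a^'a \<Rightarrow> real^'a^'a \<Rightarrow> nat \<Rightarrow> real^'a^'a"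
  where "H_inv D N K =
    inv_sqrt D ** (\<Sum>i\<le>K. mat_pow (inv_sqrt D ** N ** inv_sqrt D) i) ** inv_sqrt D"

definition DN_ADMM ::
    "nat \<Rightarrow> real \<Rightarrow> real \<Rightarrow> (real^('n \<times> 'd) \<Rightarrow> real) \<Rightarrow> (real^'d \<Rightarrow> ereal)
      \<Rightarrow> 'b \<Rightarrow> ('b \<Rightarrow> 'n) \<Rightarrow> ('b \<Rightarrow> 'n) \<Rightarrow> 'n
      \<Rightarrow> (nat \<Rightarrow> real^('n::finite \<times> 'd::finite)) \<Rightarrow> (nat \<Rightarrow> real^('b::finite \<times> 'd))
      \<Rightarrow> (nat \<Rightarrow> real^('b \<times> 'd)) \<Rightarrow> bool"
  where "DN_ADMM K \<mu> \<epsilon> F g \<omega> src dst l x z y \<longleftrightarrow>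
    (let B = B_mat \<omega> src dst l; L = laplacian \<omega> src dst in
     \<forall>t. let \<theta> = embed \<omega> (prox \<mu> g (block l (x t) + \<mu> *\<^sub>R block \<omega> (y t))) in
       x (Suc t) = x t - H_inv (D_mat F L l \<mu> \<epsilon> (x t)) (N_mat L \<mu>) K
         *v (gradient F (x t) + (1 / \<mu>) *\<^sub>R (B *v (transpose B *v x t - \<theta>)) + B *v y t) \<and>
       z (Suc t) = embed \<omega> (prox \<mu> g (block l (x (Suc t)) + \<mu> *\<^sub>R block \<omega> (y t))) \<and>
       y (Suc t) = y t + (1 / \<mu>) *\<^sub>R (transpose B *v x (Suc t) - z (Suc t)))"


section \<open>The weighted norm\<close>

definition stack :: "real^'a::finite \<Rightarrow> real^'c::finite \<Rightarrow> real^('a + 'c)"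
  where "stack x y = (\<chi> p. case p of Inl i \<Rightarrow> x $ i | Inr j \<Rightarrow> y $ j)"

definition weight_mat :: "real \<Rightarrow> real \<Rightarrow> real^('a::finite + 'c::finite)^('a + 'c)"
  where "weight_mat \<epsilon> \<mu> =
    (\<chi> p q. if p = q then (case p of Inl _ \<Rightarrow> \<epsilon> | Inr _ \<Rightarrow> \<mu>) else 0)"

definition sqnorm_wrt :: "real^'a^'a \<Rightarrow> real^'a \<Rightarrow> real"
  where "sqnorm_wrt H v = v \<bullet> (H *v v)"

end

theory Submission
  imports Defs
begin

text \<open>One step of the method is an inexact proximal step on the optimality system. Let a star mark the
optimal values and a plus the next iterates. Eliminating the approximate inverse Hessian from the
primal update and subtracting the optimality condition gives
\<open>(\<nabla>F(x\<^sup>+) - \<nabla>F(x\<^sup>*)) + B (y\<^sup>+ - y\<^sup>*) + \<epsilon> (x\<^sup>+ - x) + e = 0\<close> with \<open>|e| \<le> \<gamma> |x\<^sup>+ - x|\<close>. The error \<open>e\<close> collects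
the linearization of the gradient, the proximal point computed from \<open>x\<close> in place of \<open>x\<^sup>+\<close>, and the
truncation of the Neumann series for the inverse of \<open>D - N\<close>; this is \<open>DN_ADMM_primal_residual\<close>, and
its truncation part is \<open>H_inv_residual\<close>. The inner product of the equation with \<open>x\<^sup>+ - x\<^sup>*\<close> is
estimated from two sides. Strong monotonicity and cocoercivity of the gradient
(\<open>gradient_cocoercive\<close>) give multiples of \<open>|x\<^sup>+ - x\<^sup>*|\<^sup>2\<close> and of \<open>|\<nabla>F(x\<^sup>+) - \<nabla>F(x\<^sup>*)|\<^sup>2\<close>. The dual update
and monotonicity of the subdifferential of \<open>g\<close> (\<open>DN_ADMM_dual_step\<close>) turn the term with \<open>B\<close> into a
difference of squared dual distances. The result is that the weighted distance to the optimum
decreases, with a surplus.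

It remains to see that the surplus is a fixed fraction of the new distance. Its primal part is
visible at once. For the dual part, both \<open>y\<^sup>+\<close> and \<open>y\<^sup>*\<close> lie in the column space of the transpose of
\<open>B\<close> (\<open>DN_ADMM_dual_range\<close>), where \<open>|B v|\<^sup>2 \<ge> \<lambda> |v|\<^sup>2\<close> for the least positive eigenvalue \<open>\<lambda>\<close> of the
Gram matrix (\<open>least_pos_eigenvalue_gram\<close>), and the displayed equation bounds \<open>|B (y\<^sup>+ - y\<^sup>*)|\<close> by
quantities in the surplus. The bookkeeping is \<open>inexact_step_contraction\<close>.

The matrix functions in the iteration require the spectral theorem for real symmetric matrices,
which is derived here from the maximum of the Rayleigh quotient; the proximal operator requires
that its objective attains its minimum, which follows from compactness of parts of the epigraph.\<close>

section \<open>Symmetric matrices\<close>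

lemma symmetric_iff_inner:
  fixes A :: "real^'a^'a"
  shows "transpose A = A \<longleftrightarrow> (\<forall>x y. x \<bullet> (A *v y) = (A *v x) \<bullet> y)"
proof
  assume "transpose A = A"
  then show "\<forall>x y. x \<bullet> (A *v y) = (A *v x) \<bullet> y"
    by (metis dot_lmul_matrix transpose_matrix_vector)
next
  assume *: "\<forall>x y. x \<bullet> (A *v y) = (A *v x) \<bullet> y"
  have "(transpose A *v x) \<bullet> y = (A *v x) \<bullet> y" for x y
    using * by (simp add: dot_lmul_matrix)
  then show "transpose A = A"
    by (metis matrix_eq vector_eq_rdot)
qed

lemma inner_matrix_transpose:
  fixes A :: "real^'a^'b"
  shows "x \<bullet> (A *v y) = (transpose A *v x) \<bullet> y"
  by (simp add: dot_lmul_matrix)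

lemma mat_mult_vec: "mat c *v x = c *\<^sub>R (x::real^'a)"
  by (simp add: vec_eq_iff matrix_vector_mult_def mat_def if_distrib[of "\<lambda>u. u * _"] cong: if_cong)

lemma psd_inner_commute:
  "psd A \<Longrightarrow> x \<bullet> (A *v y) = (A *v x) \<bullet> y"
  by (simp add: psd_def symmetric_iff_inner)

lemma loewner_le_mat_iff:
  fixes A :: "real^'a^'a"
  shows "A \<preceq> mat c \<longleftrightarrow> transpose A = A \<and> (\<forall>v. v \<bullet> (A *v v) \<le> c * (v \<bullet> v))"
    and "mat c \<preceq> A \<longleftrightarrow> transpose A = A \<and> (\<forall>v. c * (v \<bullet> v) \<le> v \<bullet> (A *v v))"
  by (simp_all add: loewner_le_def psd_def symmetric_iff_inner matrix_vector_mult_diff_rdistrib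
      mat_mult_vec inner_diff_right inner_diff_left)


text \<open>First-order optimality in algebraic form: near \<open>s = 0\<close> the sign of the expression is decided
by its linear term.\<close>

lemma nonneg_quadratic_imp_linear_zero:
  fixes p q :: real
  assumes "\<And>s. 0 \<le> 2 * s * p + s\<^sup>2 * q"
  shows "p = 0"
proof (rule ccontr)
  assume "p \<noteq> 0"
  \<comment> \<open>With \<open>c > q\<close>, the choice \<open>s = - p / c\<close> makes the linear term win.\<close>
  define c where "c = \<bar>q\<bar> + 1"
  have c: "c > 0" "q < c" by (auto simp: c_def)
  have "0 \<le> 2 * (- p / c) * p + (- p / c)\<^sup>2 * q"
    by (rule assms)
  also have "\<dots> = (p\<^sup>2 / c) * (q / c - 2)"
    using c by (simp add: field_simps power2_eq_square)
  also have "\<dots> < 0"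
    using c \<open>p \<noteq> 0\<close> by (intro mult_pos_neg) (auto simp: field_simps)
  finally show False by simp
qed

text \<open>A maximizer \<open>b\<close> of the Rayleigh quotient on the unit sphere of \<open>S\<close> is an eigenvector: the form
\<open>c * (v \<bullet> v) - v \<bullet> (A *v v)\<close>, where \<open>c\<close> is the maximum, is nonnegative on \<open>S\<close> and vanishes at \<open>b\<close>,
so its derivative at \<open>b\<close> vanishes in every direction of \<open>S\<close>. Invariance of \<open>S\<close> makes the residual
\<open>c *\<^sub>R b - A *v b\<close> one of these directions.\<close>

lemma symmetric_eigenvector_in_subspace:
  fixes A :: "real^'a^'a"
  assumes sym: "transpose A = A" and S: "subspace S" "\<And>x. x \<in> S \<Longrightarrow> A *v x \<in> S" "S \<noteq> {0}"
  obtains b where "b \<in> S" "norm b = 1" "A *v b = (b \<bullet> (A *v b)) *\<^sub>R b"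
proof -
  note comm = sym[unfolded symmetric_iff_inner, rule_format]
  have "compact (S \<inter> sphere 0 1)"
    by (simp add: S(1) closed_Int_compact closed_subspace)
  moreover have "S \<inter> sphere 0 1 \<noteq> {}"
  proof -
    obtain v where "v \<in> S" "v \<noteq> 0" using S subspace_0 by blast
    then have "v /\<^sub>R norm v \<in> S \<inter> sphere 0 1" using S(1) by (simp add: subspace_scale)
    then show ?thesis by blast
  qed
  moreover have "continuous_on (S \<inter> sphere 0 1) (\<lambda>v. v \<bullet> (A *v v))"
    by (intro continuous_intros linear_continuous_on) simp
  ultimately obtain b where b: "b \<in> S" "norm b = 1"
    and max: "\<And>v. v \<in> S \<Longrightarrow> norm v = 1 \<Longrightarrow> v \<bullet> (A *v v) \<le> b \<bullet> (A *v b)"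
    using continuous_attains_sup[of "S \<inter> sphere 0 1" "\<lambda>v. v \<bullet> (A *v v)"]
    by (metis IntE IntI mem_sphere_0)
  define c where "c = b \<bullet> (A *v b)"
  have le: "v \<bullet> (A *v v) \<le> c * (v \<bullet> v)" if "v \<in> S" for v
  proof (cases "v = 0")
    case False
    have "(v /\<^sub>R norm v) \<bullet> (A *v (v /\<^sub>R norm v)) \<le> c"
      unfolding c_def using that S(1) False by (intro max) (auto simp: subspace_scale)
    then show ?thesis
      using False by (simp add: matrix_vector_mult_scaleR field_simps dot_square_norm power2_eq_square)
  qed auto
  define w where "w = c *\<^sub>R b - A *v b"
  have wS: "w \<in> S" unfolding w_def using S b by (simp add: subspace_diff subspace_scale)
  have bb: "b \<bullet> b = 1" using b by (simp add: dot_square_norm)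
  \<comment> \<open>First-order optimality of \<open>b\<close> in the direction of the residual \<open>w\<close>.\<close>
  have "0 \<le> 2 * s * (w \<bullet> w) + s\<^sup>2 * (c * (w \<bullet> w) - w \<bullet> (A *v w))" for s
  proof -
    have "b + s *\<^sub>R w \<in> S" using S b wS by (simp add: subspace_add subspace_scale)
    from le[OF this] have "(b + s *\<^sub>R w) \<bullet> (A *v (b + s *\<^sub>R w)) \<le> c * ((b + s *\<^sub>R w) \<bullet> (b + s *\<^sub>R w))" .
    moreover have "(b + s *\<^sub>R w) \<bullet> (A *v (b + s *\<^sub>R w))
        = c + 2 * s * ((A *v b) \<bullet> w) + s\<^sup>2 * (w \<bullet> (A *v w))"
      unfolding matrix_vector_right_distrib matrix_vector_mult_scaleR inner_add_left inner_add_right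
        inner_scaleR_left inner_scaleR_right comm[of b w] inner_commute[of w "A *v b"] c_def
      by (simp add: power2_eq_square algebra_simps)
    moreover have "(b + s *\<^sub>R w) \<bullet> (b + s *\<^sub>R w) = 1 + 2 * s * (b \<bullet> w) + s\<^sup>2 * (w \<bullet> w)"
      unfolding inner_add_left inner_add_right inner_scaleR_left inner_scaleR_right bb
        inner_commute[of w b]
      by (simp add: power2_eq_square algebra_simps)
    moreover have "w \<bullet> w = c * (b \<bullet> w) - (A *v b) \<bullet> w"
      by (subst (1) w_def) (simp add: inner_diff_left)
    ultimately show ?thesis
      by (simp add: distrib_left left_diff_distrib right_diff_distrib mult.assoc mult.left_commute)
  qed
  then have "w \<bullet> w = 0" by (rule nonneg_quadratic_imp_linear_zero)
  then have "A *v b = c *\<^sub>R b" by (simp add: w_def)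
  with b show thesis using that by (simp add: c_def)
qed

text \<open>The spectral theorem, by induction on the dimension: the orthogonal complement of an eigenvector
inside an invariant subspace is again invariant.\<close>

lemma symmetric_eigenbasis_subspace:
  fixes A :: "real^'a^'a"
  assumes sym: "transpose A = A" and "subspace S" "\<And>x. x \<in> S \<Longrightarrow> A *v x \<in> S"
  shows "\<exists>U. finite U \<and> U \<subseteq> S \<and> pairwise orthogonal U \<and> span U = S \<and>
    (\<forall>b\<in>U. norm b = 1 \<and> A *v b = (b \<bullet> (A *v b)) *\<^sub>R b)"
  using assms(2-)
proof (induction "dim S" arbitrary: S rule: less_induct)
  case less
  note comm = sym[unfolded symmetric_iff_inner, rule_format]
  show ?case
  proof (cases "S = {0}")
    case True
    then show ?thesis by (intro exI[of _ "{}"]) auto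
  next
    case False
    obtain b where b: "b \<in> S" "norm b = 1" "A *v b = (b \<bullet> (A *v b)) *\<^sub>R b"
      using symmetric_eigenvector_in_subspace[OF sym less.prems False] by blast
    have bb: "b \<bullet> b = 1" using b by (simp add: dot_square_norm)
    define S' where "S' = {x \<in> S. b \<bullet> x = 0}"
    have sub: "subspace S'"
      using less.prems(1) unfolding S'_def subspace_def by (auto simp: inner_add_right)
    have inv: "A *v x \<in> S'" if "x \<in> S'" for x
    proof -
      have "b \<bullet> (A *v x) = (b \<bullet> (A *v b)) * (b \<bullet> x)"
        by (subst comm, subst b(3)) simp
      then show ?thesis using that less.prems(2) by (simp add: S'_def)
    qed
    have "b \<notin> S'" "S' \<subseteq> S" using bb by (auto simp: S'_def)
    then have "S' \<subset> S" using b by blast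
    then have "dim S' < dim S"
      using sub less.prems(1) by (intro dim_psubset) (simp add: span_eq_iff[THEN iffD2])
    from less.hyps[OF this sub inv] obtain U where U: "finite U" "U \<subseteq> S'" "pairwise orthogonal U"
      "span U = S'" "\<forall>b\<in>U. norm b = 1 \<and> A *v b = (b \<bullet> (A *v b)) *\<^sub>R b" by blast
    have "span (insert b U) = S"
    proof
      show "span (insert b U) \<subseteq> S"
        using U(2) b(1) less.prems(1) by (intro span_minimal) (auto simp: S'_def)
      show "S \<subseteq> span (insert b U)"
      proof
        fix x assume "x \<in> S"
        then have "x - (b \<bullet> x) *\<^sub>R b \<in> S'"
          using b bb less.prems(1) by (simp add: S'_def subspace_diff subspace_scale inner_diff_right)
        then show "x \<in> span (insert b U)" using U(4) by (auto simp: span_insert)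
      qed
    qed
    moreover have "pairwise orthogonal (insert b U)"
      using U(2,3) by (auto simp: pairwise_insert S'_def orthogonal_def inner_commute)
    ultimately show ?thesis
      using U b by (intro exI[of _ "insert b U"]) (auto simp: S'_def)
  qed
qed

text \<open>The eigenvalue of \<open>b\<close> is written as its Rayleigh quotient, so that an eigenbasis is a bare set of
vectors and carries no separate eigenvalue function.\<close>

definition eigenbasis :: "real^'a^'a \<Rightarrow> (real^'a) set \<Rightarrow> bool"
  where "eigenbasis A U \<longleftrightarrow> finite U \<and> pairwise orthogonal U \<and> span U = UNIV \<and>
    (\<forall>b\<in>U. norm b = 1 \<and> A *v b = (b \<bullet> (A *v b)) *\<^sub>R b)"

lemma ex_eigenbasis:
  assumes "transpose A = (A :: real^'a^'a)"
  obtains U where "eigenbasis A U"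
  using symmetric_eigenbasis_subspace[OF assms, of UNIV] unfolding eigenbasis_def by auto

context
  fixes A :: "real^'a^'a" and U
  assumes sym: "transpose A = A" and U: "eigenbasis A U"
begin

lemma eigenbasis_finite: "finite U"
  using U by (simp add: eigenbasis_def)

lemma eigenbasis_inner: "b \<in> U \<Longrightarrow> c \<in> U \<Longrightarrow> b \<bullet> c = (if b = c then 1 else 0)"
  using U by (auto simp: eigenbasis_def pairwise_def orthogonal_def dot_square_norm)

lemma eigenbasis_expand: "(\<Sum>b\<in>U. (x \<bullet> b) *\<^sub>R b) = x"
  using U by (intro orthonormal_basis_expand) (auto simp: eigenbasis_def)

lemma eigenbasis_parseval: "x \<bullet> y = (\<Sum>b\<in>U. (x \<bullet> b) * (y \<bullet> b))"
proof -
  have "(\<Sum>b\<in>U. (x \<bullet> b) *\<^sub>R b) \<bullet> y = (\<Sum>b\<in>U. (x \<bullet> b) * (y \<bullet> b))"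
    by (simp add: inner_sum_left inner_commute[of y])
  then show ?thesis by (simp add: eigenbasis_expand)
qed

lemma eigenbasis_apply: "b \<in> U \<Longrightarrow> (A *v x) \<bullet> b = (b \<bullet> (A *v b)) * (x \<bullet> b)"
proof -
  assume "b \<in> U"
  then have "A *v b = (b \<bullet> (A *v b)) *\<^sub>R b" using U by (simp add: eigenbasis_def)
  then have "x \<bullet> (A *v b) = (b \<bullet> (A *v b)) * (x \<bullet> b)" by (metis inner_scaleR_right)
  then show ?thesis using sym by (simp add: symmetric_iff_inner)
qed

lemma eigenbasis_norm: "b \<in> U \<Longrightarrow> norm b = 1"
  using U by (simp add: eigenbasis_def)

lemma eigenvalue_in_eigenbasis:
  assumes "A *v v = c *\<^sub>R v" "v \<noteq> 0"
  obtains b where "b \<in> U" "b \<bullet> (A *v b) = c"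
proof -
  obtain b where b: "b \<in> U" "v \<bullet> b \<noteq> 0"
  proof (rule ccontr)
    assume "\<not> thesis"
    then have "\<And>b. b \<in> U \<Longrightarrow> v \<bullet> b = 0" using that by blast
    then have "v \<bullet> v = 0" by (subst eigenbasis_parseval) simp
    with assms show False by simp
  qed
  then have "(b \<bullet> (A *v b)) * (v \<bullet> b) = c * (v \<bullet> b)"
    using eigenbasis_apply[of b v] assms by simp
  with b that show thesis by simp
qed

end

text \<open>For a symmetric matrix the quadratic form determines the operator norm. This turns Loewner bounds
into norm bounds.\<close>

lemma symmetric_norm_le:
  fixes A :: "real^'a^'a"
  assumes sym: "transpose A = A" and bnd: "\<And>v. \<bar>v \<bullet> (A *v v)\<bar> \<le> r * (v \<bullet> v)"
  shows "norm (A *v v) \<le> r * norm v"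
proof -
  obtain U where U: "eigenbasis A U" by (rule ex_eigenbasis[OF sym])
  note ap = eigenbasis_apply[OF sym U] and pv = eigenbasis_parseval[OF sym U]
    and nm = eigenbasis_norm[OF sym U]
  have r: "0 \<le> r"
    using bnd[of "axis undefined 1"] by (simp add: inner_axis_axis)
  have "(A *v v) \<bullet> (A *v v) = (\<Sum>b\<in>U. (b \<bullet> (A *v b))\<^sup>2 * (v \<bullet> b)\<^sup>2)"
    by (subst pv) (auto simp: ap power2_eq_square intro!: sum.cong)
  also have "\<dots> \<le> (\<Sum>b\<in>U. r\<^sup>2 * (v \<bullet> b)\<^sup>2)"
  proof (intro sum_mono mult_right_mono)
    fix b assume "b \<in> U"
    then have "\<bar>b \<bullet> (A *v b)\<bar> \<le> r" using bnd[of b] nm by (simp add: dot_square_norm)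
    then show "(b \<bullet> (A *v b))\<^sup>2 \<le> r\<^sup>2" using r by (simp add: power2_le_iff_abs_le)
  qed simp
  also have "\<dots> = r\<^sup>2 * (v \<bullet> v)"
    by (subst pv) (simp add: sum_distrib_left power2_eq_square)
  finally have "(norm (A *v v))\<^sup>2 \<le> (r * norm v)\<^sup>2"
    by (simp add: dot_square_norm power_mult_distrib)
  then show ?thesis using r by (simp add: power2_le_iff_abs_le)
qed


text \<open>In an eigenbasis of \<open>A\<close> the root is diagonal, with the square roots of the eigenvalues.\<close>

lemma psd_sqrt_exists:
  assumes "psd (A :: real^'a^'a)"
  shows "\<exists>S. psd S \<and> S ** S = A"
proof -
  have sym: "transpose A = A" and nn: "\<And>v. 0 \<le> v \<bullet> (A *v v)" using assms by (auto simp: psd_def)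
  obtain U where U: "eigenbasis A U" by (rule ex_eigenbasis[OF sym])
  note ap = eigenbasis_apply[OF sym U] and pv = eigenbasis_parseval[OF sym U]
  define s where "s b = sqrt (b \<bullet> (A *v b))" for b
  define S where "S = matrix (\<lambda>x. \<Sum>b\<in>U. (s b * (x \<bullet> b)) *\<^sub>R b)"
  have "linear (\<lambda>x. \<Sum>b\<in>U. (s b * (x \<bullet> b)) *\<^sub>R b)"
    by (intro linear_compose_sum ballI linearI)
      (auto simp: inner_add_left algebra_simps)
  then have S: "S *v x = (\<Sum>b\<in>U. (s b * (x \<bullet> b)) *\<^sub>R b)" for x
    by (simp add: S_def matrix_works)
  have Sb: "(S *v x) \<bullet> b = s b * (x \<bullet> b)" if "b \<in> U" for x b
  proof -
    have "(S *v x) \<bullet> b = (\<Sum>c\<in>U. if c = b then s c * (x \<bullet> c) else 0)"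
      unfolding S inner_sum_left by (intro sum.cong) (auto simp: eigenbasis_inner[OF sym U] that)
    then show ?thesis using that eigenbasis_finite[OF sym U] by simp
  qed
  have "transpose S = S"
    unfolding symmetric_iff_inner
  proof (intro allI)
    fix x y
    show "x \<bullet> (S *v y) = (S *v x) \<bullet> y"
      by (subst pv[of x "S *v y"], subst pv[of "S *v x" y], intro sum.cong) (auto simp: Sb)
  qed
  moreover have "0 \<le> v \<bullet> (S *v v)" for v
    by (subst pv) (auto simp: Sb s_def nn mult.left_commute[of "v \<bullet> _"] intro!: sum_nonneg)
  moreover have "(S ** S) *v x = A *v x" for x
  proof -
    have "(S *v (S *v x)) \<bullet> b = (A *v x) \<bullet> b" if "b \<in> U" for b
    proof -
      have "s b * s b = b \<bullet> (A *v b)" by (simp add: s_def nn)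
      then show ?thesis by (metis Sb ap mult.assoc that)
    qed
    then have "(S *v (S *v x)) \<bullet> y = (A *v x) \<bullet> y" for y
      by (subst (1 2) pv, intro sum.cong) auto
    then have "S *v (S *v x) = A *v x" by (metis vector_eq_rdot)
    then show ?thesis by (simp add: matrix_vector_mul_assoc)
  qed
  ultimately show ?thesis by (auto simp: psd_def matrix_eq)
qed

text \<open>Every positive semidefinite root acts on an eigenvector \<open>b\<close> of \<open>A\<close>, with eigenvalue \<open>c\<close>, as
multiplication by \<open>sqrt c\<close>. For \<open>c = 0\<close>, the square of \<open>norm (R *v b)\<close> is \<open>b \<bullet> (A *v b) = 0\<close>. For
\<open>c > 0\<close>, the residual \<open>w = R *v b - sqrt c *\<^sub>R b\<close> satisfies \<open>R *v w = - sqrt c *\<^sub>R w\<close>, which positivity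
of \<open>R\<close> excludes unless \<open>w = 0\<close>. Two roots therefore agree on an eigenbasis of \<open>A\<close>.\<close>

lemma psd_sqrt_unique:
  assumes S: "psd S" "S ** S = A" and T: "psd T" "T ** T = (A :: real^'a^'a)"
  shows "S = T"
proof -
  have "psd A"
  proof -
    have "transpose A = A" using S by (metis matrix_transpose_mul psd_def)
    moreover have "v \<bullet> (A *v v) = (S *v v) \<bullet> (S *v v)" for v
      using S(2) psd_inner_commute[OF S(1)] by (metis matrix_vector_mul_assoc)
    ultimately show ?thesis by (simp add: psd_def)
  qed
  then have sym: "transpose A = A" and nn: "\<And>v. 0 \<le> v \<bullet> (A *v v)" by (auto simp: psd_def)
  obtain U where U: "eigenbasis A U" by (rule ex_eigenbasis[OF sym])
  have root: "R *v b = sqrt (b \<bullet> (A *v b)) *\<^sub>R b" if R: "psd R" "R ** R = A" and b: "b \<in> U" for R b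
  proof -
    define c where "c = b \<bullet> (A *v b)"
    have Ab: "A *v b = c *\<^sub>R b" using U b by (simp add: eigenbasis_def c_def)
    have RR: "R *v (R *v v) = A *v v" for v using R(2) by (simp add: matrix_vector_mul_assoc)
    show ?thesis
    proof (cases "c = 0")
      case True
      have "(R *v b) \<bullet> (R *v b) = 0"
        using psd_inner_commute[OF R(1)] RR by (metis True c_def)
      then show ?thesis using True by (simp add: c_def)
    next
      case False
      then have c: "c > 0" using nn[of b] by (simp add: c_def)
      define w where "w = R *v b - sqrt c *\<^sub>R b"
      have "R *v w + sqrt c *\<^sub>R w = 0"
        using c Ab by (simp add: w_def matrix_vector_mult_diff_distrib RR matrix_vector_mult_scaleR
            scaleR_diff_right)
      then have "w \<bullet> (R *v w) + sqrt c * (w \<bullet> w) = 0"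
        by (metis inner_add_right inner_scaleR_right inner_zero_right)
      moreover have "0 \<le> w \<bullet> (R *v w)" "0 \<le> sqrt c * (w \<bullet> w)" using R(1) c by (auto simp: psd_def)
      ultimately have "w = 0" using c by (simp add: add_nonneg_eq_0_iff)
      then show ?thesis by (simp add: w_def c_def)
    qed
  qed
  have "S *v x = T *v x" for x
  proof (rule linear_eq_on_span[of "(*v) S" "(*v) T" U])
    show "x \<in> span U" using U by (simp add: eigenbasis_def)
  qed (use root S T in auto)
  then show ?thesis by (simp add: matrix_eq)
qed

lemma psd_sqrt:
  assumes "psd A"
  shows "psd (psd_sqrt A)" "psd_sqrt A ** psd_sqrt A = A"
proof -
  have "\<exists>!S. psd S \<and> S ** S = A"
    using psd_sqrt_exists[OF assms] psd_sqrt_unique by blast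
  from theI'[OF this] show "psd (psd_sqrt A)" "psd_sqrt A ** psd_sqrt A = A"
    by (auto simp: psd_sqrt_def)
qed

text \<open>Both \<^const>\<open>psd_sqrt\<close> and \<^const>\<open>inv_sqrt\<close> are defined by description and choice; these equations are
all that the later arguments use.\<close>

lemma inv_sqrt:
  fixes A :: "real^'a^'a"
  assumes A: "psd A" and pd: "c > 0" "\<And>v. c * (v \<bullet> v) \<le> v \<bullet> (A *v v)"
  shows "psd_sqrt A ** inv_sqrt A = mat 1" "inv_sqrt A ** psd_sqrt A = mat 1"
    "transpose (inv_sqrt A) = inv_sqrt A"
proof -
  define S where "S = psd_sqrt A"
  have S: "psd S" "S ** S = A" using psd_sqrt[OF A] by (auto simp: S_def)
  have "x = 0" if "S *v x = 0" for x
  proof -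
    have "A *v x = 0" using that S(2) by (metis matrix_vector_mul_assoc matrix_vector_mult_0_right)
    then have "c * (x \<bullet> x) \<le> 0" using pd(2)[of x] by simp
    then have "x \<bullet> x \<le> 0" using pd(1) by (simp add: mult_le_0_iff)
    then show ?thesis by (metis inner_eq_zero_iff inner_ge_zero order_antisym)
  qed
  then have "invertible S"
    by (metis invertible_left_inverse matrix_left_invertible_ker)
  then have inv: "S ** inv_sqrt A = mat 1" "inv_sqrt A ** S = mat 1"
    unfolding invertible_def inv_sqrt_def matrix_inv_def S_def[symmetric]
    by (auto intro: someI2_ex)
  then show "psd_sqrt A ** inv_sqrt A = mat 1" "inv_sqrt A ** psd_sqrt A = mat 1"
    by (auto simp: S_def)
  have "transpose S = S" using S by (simp add: psd_def)
  then have "transpose (inv_sqrt A) ** S = mat 1"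
    using inv(1) by (metis matrix_transpose_mul transpose_mat)
  then show "transpose (inv_sqrt A) = inv_sqrt A"
    using inv(1) by (metis matrix_mul_assoc matrix_mul_lid matrix_mul_rid)
qed

text \<open>The column space of \<open>transpose B\<close> is orthogonal to the kernel of \<open>B\<close>, which is the kernel of the
Gram matrix. In an eigenbasis of the Gram matrix a vector of this space thus has no component
with eigenvalue zero. All positive eigenvalues occur in the eigenbasis, so the minimum that
defines \<^const>\<open>least_pos_eigenvalue\<close> ranges over a finite set.\<close>

lemma least_pos_eigenvalue_gram:
  fixes B :: "real^'b^'a"
  shows "B \<noteq> 0 \<Longrightarrow> 0 < least_pos_eigenvalue (transpose B ** B)"
    and "y \<in> span (columns (transpose B)) \<Longrightarrow>
      least_pos_eigenvalue (transpose B ** B) * (y \<bullet> y) \<le> (B *v y) \<bullet> (B *v y)"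
proof -
  define A where "A = transpose B ** B"
  define P where "P = {c. 0 < c \<and> is_eigenvalue A c}"
  have sym: "transpose A = A" by (simp add: A_def matrix_transpose_mul)
  have quad: "x \<bullet> (A *v v) = (B *v x) \<bullet> (B *v v)" for x v
    unfolding A_def by (simp add: matrix_vector_mul_assoc[symmetric] inner_matrix_transpose
        del: transpose_matrix_vector)
  obtain U where U: "eigenbasis A U" by (rule ex_eigenbasis[OF sym])
  note ap = eigenbasis_apply[OF sym U] and pv = eigenbasis_parseval[OF sym U]
  have "P \<subseteq> (\<lambda>b. b \<bullet> (A *v b)) ` U"
  proof
    fix c assume "c \<in> P"
    then obtain v where "v \<noteq> 0" "A *v v = c *\<^sub>R v" by (auto simp: P_def is_eigenvalue_def)
    from eigenvalue_in_eigenbasis[OF sym U this(2,1)] show "c \<in> (\<lambda>b. b \<bullet> (A *v b)) ` U" by blast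
  qed
  then have fin: "finite P" using eigenbasis_finite[OF sym U] finite_surj by blast
  have mem: "b \<bullet> (A *v b) \<in> P" if "b \<in> U" "b \<bullet> (A *v b) \<noteq> 0" for b
  proof -
    have "b \<noteq> 0" "A *v b = (b \<bullet> (A *v b)) *\<^sub>R b" using U that by (auto simp: eigenbasis_def)
    moreover have "b \<bullet> (A *v b) > 0" using that quad[of b b] by (metis inner_gt_zero_iff inner_zero_left)
    ultimately show ?thesis unfolding P_def is_eigenvalue_def by blast
  qed
  have lm: "least_pos_eigenvalue (transpose B ** B) = Min P"
    by (simp add: least_pos_eigenvalue_def P_def A_def)
  show "0 < least_pos_eigenvalue (transpose B ** B)" if "B \<noteq> 0"
  proof -
    have "P \<noteq> {}"
    proof
      assume "P = {}"
      then have "\<And>b. b \<in> U \<Longrightarrow> b \<bullet> (A *v b) = 0" using mem by blast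
      then have "(A *v x) \<bullet> x = 0" for x
        by (subst pv, intro sum.neutral) (auto simp: ap)
      then have "B *v x = 0" for x using quad[of x x] by (simp add: inner_commute)
      then have "B = 0" by (simp add: matrix_eq)
      with that show False by simp
    qed
    then have "Min P \<in> P" using fin by (rule Min_in[rotated])
    then show ?thesis by (simp add: lm P_def)
  qed
  show "least_pos_eigenvalue (transpose B ** B) * (y \<bullet> y) \<le> (B *v y) \<bullet> (B *v y)"
    if y: "y \<in> span (columns (transpose B))"
  proof -
    have "span (columns (transpose B)) \<subseteq> range ((*v) (transpose B))"
    proof (rule span_minimal)
      show "columns (transpose B) \<subseteq> range ((*v) (transpose B))"
        unfolding columns_def matrix_vector_mult_basis[symmetric] by blast
    qed (simp add: linear_subspace_image del: transpose_matrix_vector)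
    then obtain w where w: "y = transpose B *v w" using y by auto
    have "least_pos_eigenvalue (transpose B ** B) * (y \<bullet> y)
        = (\<Sum>b\<in>U. Min P * (y \<bullet> b)\<^sup>2)"
      by (subst pv) (simp add: lm sum_distrib_left power2_eq_square)
    also have "\<dots> \<le> (\<Sum>b\<in>U. (b \<bullet> (A *v b)) * (y \<bullet> b)\<^sup>2)"
    proof (intro sum_mono)
      fix b assume b: "b \<in> U"
      show "Min P * (y \<bullet> b)\<^sup>2 \<le> (b \<bullet> (A *v b)) * (y \<bullet> b)\<^sup>2"
      proof (cases "b \<bullet> (A *v b) = 0")
        case True
        then have "B *v b = 0" using quad[of b b] by simp
        then have "y \<bullet> b = 0"
          unfolding w by (simp add: inner_matrix_transpose[symmetric] del: transpose_matrix_vector)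
        then show ?thesis by simp
      next
        case False
        then show ?thesis using mem[OF b] fin by (intro mult_right_mono Min_le) auto
      qed
    qed
    also have "\<dots> = (A *v y) \<bullet> y"
      by (subst pv, intro sum.cong) (auto simp: ap power2_eq_square)
    also have "\<dots> = (B *v y) \<bullet> (B *v y)" by (simp add: quad inner_commute)
    finally show ?thesis .
  qed
qed

section \<open>Truncated Neumann series\<close>

lemma sum_matrix_vector_mult:
  fixes M :: "'i \<Rightarrow> real^'a^'b"
  shows "(\<Sum>i\<in>I. M i) *v v = (\<Sum>i\<in>I. M i *v v)"
  by (induction I rule: infinite_finite_induct) (auto simp: matrix_vector_mult_add_rdistrib)

lemma mat_pow_eigenvector:
  assumes "X *v b = c *\<^sub>R b"
  shows "mat_pow X i *v b = c ^ i *\<^sub>R (b :: real^'a)"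
  by (induction i) (simp_all add: matrix_vector_mul_assoc[symmetric] assms matrix_vector_mult_scaleR)

lemma mat_pow_symmetric_inner:
  assumes "transpose X = (X :: real^'a^'a)"
  shows "x \<bullet> (mat_pow X i *v y) = (mat_pow X i *v x) \<bullet> y"
proof (induction i arbitrary: x y)
  case (Suc i)
  have comm: "X *v (mat_pow X i *v v) = mat_pow X i *v (X *v v)" for v
    by (induction i) (simp_all add: matrix_vector_mul_assoc[symmetric])
  show ?case
    using assms by (simp add: matrix_vector_mul_assoc[symmetric] symmetric_iff_inner comm Suc)
qed simp

lemma neumann_telescope:
  "(mat 1 - X) ** (\<Sum>i\<le>K. mat_pow X i) = mat 1 - mat_pow X (Suc K)" for X :: "real^'a^'a"
proof -
  have "(mat 1 - X) ** (\<Sum>i\<le>K. mat_pow X i) *v v = (mat 1 - mat_pow X (Suc K)) *v v" for v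
    by (induction K)
      (simp_all add: matrix_vector_mul_assoc[symmetric] matrix_vector_mult_diff_rdistrib
        matrix_vector_mult_add_rdistrib matrix_vector_right_distrib)
  then show ?thesis by (simp add: matrix_eq)
qed

text \<open>In an eigenbasis of \<open>X\<close> the claim reads \<open>c ^ Suc K \<le> \<rho> ^ Suc K * (\<Sum>i\<le>K. c ^ i)\<close> for an eigenvalue
\<open>0 \<le> c \<le> \<rho>\<close>, and the sum is at least its term \<open>i = 0\<close>, which is 1. Comparing with the truncated
sum applied to \<open>s\<close>, and not with \<open>s\<close>, gives a bound in terms of the step that is actually
taken.\<close>

lemma neumann_remainder_le:
  fixes X :: "real^'a^'a"
  assumes sym: "transpose X = X"
    and bnd: "\<And>v. 0 \<le> v \<bullet> (X *v v)" "\<And>v. v \<bullet> (X *v v) \<le> \<rho> * (v \<bullet> v)"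
  shows "norm (mat_pow X (Suc K) *v s) \<le> \<rho> ^ Suc K * norm ((\<Sum>i\<le>K. mat_pow X i) *v s)"
proof -
  obtain U where U: "eigenbasis X U" by (rule ex_eigenbasis[OF sym])
  note pv = eigenbasis_parseval[OF sym U]
  define e where "e b = b \<bullet> (X *v b)" for b
  have pow: "(mat_pow X i *v s) \<bullet> b = e b ^ i * (s \<bullet> b)" if "b \<in> U" for i b
  proof -
    have "X *v b = e b *\<^sub>R b" using U that by (simp add: eigenbasis_def e_def)
    from mat_pow_eigenvector[OF this, of i] mat_pow_symmetric_inner[OF sym, of s i b]
    show ?thesis by simp
  qed
  have e: "0 \<le> e b" "e b \<le> \<rho>" if "b \<in> U" for b
    using bnd[of b] eigenbasis_norm[OF sym U that] by (auto simp: e_def dot_square_norm)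
  have r: "0 \<le> \<rho>"
    using bnd[of "axis undefined 1"] by (simp add: inner_axis_axis)
  have "(norm (mat_pow X (Suc K) *v s))\<^sup>2 = (\<Sum>b\<in>U. (e b ^ Suc K)\<^sup>2 * (s \<bullet> b)\<^sup>2)"
    unfolding dot_square_norm[symmetric]
    by (subst pv, intro sum.cong refl) (simp only: pow power2_eq_square mult_ac)
  also have "\<dots> \<le> (\<Sum>b\<in>U. (\<rho> ^ Suc K * (\<Sum>i\<le>K. e b ^ i))\<^sup>2 * (s \<bullet> b)\<^sup>2)"
  proof (intro sum_mono mult_right_mono power_mono)
    fix b assume b: "b \<in> U"
    have "1 \<le> (\<Sum>i\<le>K. e b ^ i)"
      using e[OF b] member_le_sum[of 0 "{..K}" "\<lambda>i. e b ^ i"] by simp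
    then have "e b ^ Suc K * 1 \<le> \<rho> ^ Suc K * (\<Sum>i\<le>K. e b ^ i)"
      using e[OF b] r by (intro mult_mono power_mono zero_le_power) auto
    then show "e b ^ Suc K \<le> \<rho> ^ Suc K * (\<Sum>i\<le>K. e b ^ i)" by simp
    show "0 \<le> e b ^ Suc K" using e[OF b] by simp
  qed simp
  also have "\<dots> = (\<rho> ^ Suc K * norm ((\<Sum>i\<le>K. mat_pow X i) *v s))\<^sup>2"
  proof -
    have "((\<Sum>i\<le>K. mat_pow X i) *v s) \<bullet> b = (\<Sum>i\<le>K. e b ^ i) * (s \<bullet> b)" if "b \<in> U" for b
      by (simp add: sum_matrix_vector_mult inner_sum_left pow that sum_distrib_right)
    then show ?thesis
      unfolding power_mult_distrib dot_square_norm[symmetric]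
      by (subst pv) (simp add: sum_distrib_left power2_eq_square mult_ac cong: sum.cong)
  qed
  finally show ?thesis
    using r by (simp add: power2_le_iff_abs_le abs_le_square_iff)
qed

text \<open>The error of solving \<open>(D - N) *v p = r\<close> approximately by \<open>p = H_inv D N K *v r\<close>, measured by the
length of \<open>p\<close>. With \<open>S\<close> the root of \<open>D\<close>, \<open>R\<close> its inverse and \<open>X = R ** N ** R\<close> one has
\<open>D - N = S ** (mat 1 - X) ** S\<close>, so the geometric sum telescopes and the residual is
\<open>S *v (mat_pow X (Suc K) *v (R *v r))\<close>. The relative bound \<open>N \<le> \<rho> D\<close> says \<open>X \<le> \<rho>\<close>. The two factors
\<open>S\<close>, one in the residual and one between \<open>p\<close> and the truncated sum, cost \<open>sqrt d\<close> each.\<close>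

lemma H_inv_residual:
  fixes D N :: "real^'a^'a"
  assumes D: "transpose D = D" "0 < c" "\<And>v. c * (v \<bullet> v) \<le> v \<bullet> (D *v v)"
      "\<And>v. v \<bullet> (D *v v) \<le> d * (v \<bullet> v)"
    and N: "psd N" "\<And>v. v \<bullet> (N *v v) \<le> \<rho> * (v \<bullet> (D *v v))"
  shows "norm (r - (D - N) *v (H_inv D N K *v r)) \<le> d * \<rho> ^ Suc K * norm (H_inv D N K *v r)"
proof -
  define S R where "S = psd_sqrt D" and "R = inv_sqrt D"
  have "0 \<le> v \<bullet> (D *v v)" for v
    using D(2) D(3)[of v] by (meson inner_ge_zero less_imp_le mult_nonneg_nonneg order_trans)
  then have psdD: "psd D" using D(1) by (simp add: psd_def)
  have S: "psd S" "S ** S = D" using psd_sqrt[OF psdD] by (auto simp: S_def)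
  have R: "S ** R = mat 1" "R ** S = mat 1" "transpose R = R"
    using inv_sqrt[OF psdD D(2,3)] by (auto simp: S_def R_def)
  have SR: "S *v (R *v v) = v" and RS: "R *v (S *v v) = v" and SS: "S *v (S *v v) = D *v v" for v
    using R S by (simp_all add: matrix_vector_mul_assoc)
  have Rc: "x \<bullet> (R *v v) = (R *v x) \<bullet> v" for x v using R(3) by (simp add: symmetric_iff_inner)
  have normS: "(S *v v) \<bullet> (S *v v) = v \<bullet> (D *v v)" for v
    using psd_inner_commute[OF S(1), of v "S *v v"] by (simp add: SS)
  define X where "X = R ** N ** R"
  have X: "X *v v = R *v (N *v (R *v v))" for v by (simp add: X_def matrix_vector_mul_assoc matrix_mul_assoc)
  have symX: "transpose X = X"
    unfolding symmetric_iff_inner by (simp add: X Rc psd_inner_commute[OF N(1)])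
  have X0: "0 \<le> v \<bullet> (X *v v)" for v
    using N(1) by (simp add: X Rc psd_def)
  have X1: "v \<bullet> (X *v v) \<le> \<rho> * (v \<bullet> v)" for v
    using N(2)[of "R *v v"] normS[of "R *v v"] by (simp add: X Rc SR)
  define Q s where "Q = (\<Sum>i\<le>K. mat_pow X i)" and "s = R *v r"
  have P: "H_inv D N K *v r = R *v (Q *v s)"
    by (simp add: H_inv_def Q_def s_def X_def R_def matrix_vector_mul_assoc matrix_mul_assoc)
  have "(D - N) *v (R *v v) = S *v ((mat 1 - X) *v v)" for v
    by (simp add: X SR matrix_vector_mult_diff_rdistrib matrix_vector_mult_diff_distrib
        flip: SS)
  then have "(D - N) *v (H_inv D N K *v r) = S *v ((mat 1 - mat_pow X (Suc K)) *v s)"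
    unfolding P Q_def neumann_telescope[symmetric]
    by (simp only: matrix_vector_mul_assoc[of "mat 1 - X", symmetric])
  also have "\<dots> = r - S *v (mat_pow X (Suc K) *v s)"
    by (simp add: matrix_vector_mult_diff_rdistrib matrix_vector_mult_diff_distrib s_def SR
        del: mat_pow.simps)
  finally have res: "r - (D - N) *v (H_inv D N K *v r) = S *v (mat_pow X (Suc K) *v s)" by simp
  have d: "0 \<le> d" using D(2) D(3)[of "axis undefined 1"] D(4)[of "axis undefined 1"] by (simp add: inner_axis_axis)
  have S_le: "norm (S *v v) \<le> sqrt d * norm v" for v
    using D(4)[of v] normS[of v] d
    by (metis norm_eq_sqrt_inner real_sqrt_le_iff real_sqrt_mult)
  have "norm (S *v (mat_pow X (Suc K) *v s)) \<le> sqrt d * norm (mat_pow X (Suc K) *v s)"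
    by (rule S_le)
  also have "\<dots> \<le> sqrt d * (\<rho> ^ Suc K * norm (Q *v s))"
    using neumann_remainder_le[OF symX X0 X1] d unfolding Q_def by (intro mult_left_mono) auto
  also have "norm (Q *v s) \<le> sqrt d * norm (R *v (Q *v s))"
    using S_le[of "R *v (Q *v s)"] by (simp add: SR)
  then have "sqrt d * (\<rho> ^ Suc K * norm (Q *v s)) \<le> sqrt d * (\<rho> ^ Suc K * (sqrt d * norm (R *v (Q *v s))))"
    using d X0[of "axis undefined 1"] X1[of "axis undefined 1"]
    by (intro mult_left_mono zero_le_power) (auto simp: inner_axis_axis)
  also have "\<dots> = d * \<rho> ^ Suc K * norm (H_inv D N K *v r)"
    using d by (simp add: P)
  finally show ?thesis unfolding res .
qed

section \<open>The proximal operator\<close>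

lemma proper_finite:
  assumes "proper g" "g x \<noteq> \<infinity>"
  obtains a where "g x = ereal a"
  using assms unfolding proper_def by (cases "g x") auto

lemma properE:
  assumes "proper g"
  obtains x a where "g x = ereal a"
proof -
  obtain x where "g x \<noteq> \<infinity>" using assms unfolding proper_def by blast
  then obtain a where "g x = ereal a" by (rule proper_finite[OF assms])
  then show thesis by (rule that)
qed

text \<open>Points of the ball with values tending to \<open>-\<infinity>\<close> would accumulate at a point \<open>L\<close>, and closedness of
the epigraph would put the whole vertical line over \<open>L\<close> into it.\<close>

lemma closed_fun_bounded_below_cball:
  fixes g :: "'a::euclidean_space \<Rightarrow> ereal"
  assumes g: "proper g" "closed_fun g"
  obtains c where "\<And>w. w \<in> cball z0 e \<Longrightarrow> ereal c \<le> g w"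
proof (rule ccontr)
  assume "\<not> thesis"
  then have "\<exists>w. w \<in> cball z0 e \<and> g w < ereal (- real n)" for n
    using that by (meson not_le)
  then obtain w where w: "\<And>n. w n \<in> cball z0 e" "\<And>n. g (w n) < ereal (- real n)" by metis
  obtain L r where "strict_mono r" and lim: "(w \<circ> r) \<longlonglongrightarrow> L"
    using compact_cball[of z0 e] w(1) unfolding compact_def by blast
  have "g L \<le> ereal a" for a
  proof -
    obtain k where k: "- a < real k" using reals_Archimedean2 by blast
    have "(w (r n), a) \<in> ext_epigraph g" if "n \<ge> k" for n
    proof -
      have "r n \<ge> n" using \<open>strict_mono r\<close> by (simp add: seq_suble)
      then have "ereal (- real (r n)) \<le> ereal a" using k that by simp
      then have "g (w (r n)) \<le> ereal a" using w(2)[of "r n"] by (meson less_imp_le order_trans)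
      then show ?thesis by (simp add: ext_epigraph_def)
    qed
    then have "eventually (\<lambda>n. (w (r n), a) \<in> ext_epigraph g) sequentially"
      by (auto simp: eventually_sequentially)
    moreover have "(\<lambda>n. (w (r n), a)) \<longlonglongrightarrow> (L, a)"
      using lim by (intro tendsto_Pair tendsto_const) (simp add: o_def)
    ultimately have "(L, a) \<in> ext_epigraph g"
      using g(2) unfolding closed_fun_def by (intro Lim_in_closed_set[of _ _ sequentially]) auto
    then show ?thesis by (simp add: ext_epigraph_def)
  qed
  then have "g L = - \<infinity>" by (metis ereal_bot)
  then show False using g(1) by (simp add: proper_def)
qed

text \<open>A lower bound \<open>c\<close> on the unit ball about \<open>z0\<close> propagates to all of space: the segment from \<open>z0\<close> to
a point at distance \<open>R > 1\<close> meets the unit sphere at the fraction \<open>1 / R\<close>, and convexity bounds the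
value there by the values at the two ends.\<close>

lemma convex_fun_linear_minorant:
  fixes g :: "'a::euclidean_space \<Rightarrow> ereal"
  assumes g: "proper g" "closed_fun g" "convex_fun g" and z0: "g z0 = ereal a0"
  obtains c k where "k \<ge> 0" "\<And>z r. g z \<le> ereal r \<Longrightarrow> c - k * norm (z - z0) \<le> r"
proof -
  obtain c where c: "\<And>w. w \<in> cball z0 1 \<Longrightarrow> ereal c \<le> g w"
    using closed_fun_bounded_below_cball[OF g(1,2), of z0 1] by blast
  have k: "0 \<le> a0 - c" using c[of z0] z0 by simp
  have "c - (a0 - c) * norm (z - z0) \<le> r" if zr: "g z \<le> ereal r" for z r
  proof (cases "norm (z - z0) \<le> 1")
    case True
    then have "ereal c \<le> g z" by (intro c) (simp add: dist_norm norm_minus_commute)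
    then have "c \<le> r" using zr by (metis ereal_less_eq(3) order_trans)
    moreover have "0 \<le> (a0 - c) * norm (z - z0)" using k by simp
    ultimately show ?thesis by linarith
  next
    case False
    define R where "R = norm (z - z0)"
    have R: "R > 1" using False by (simp add: R_def)
    have "(1 - 1 / R) *\<^sub>R (z0, a0) + (1 / R) *\<^sub>R (z, r) \<in> ext_epigraph g"
      using g(3) zr z0 R unfolding convex_fun_def
      by (intro convexD) (auto simp: ext_epigraph_def)
    then have "g (z0 + (1 / R) *\<^sub>R (z - z0)) \<le> ereal ((1 - 1 / R) * a0 + (1 / R) * r)"
      by (simp add: ext_epigraph_def algebra_simps)
    moreover have "ereal c \<le> g (z0 + (1 / R) *\<^sub>R (z - z0))"
      using R by (intro c) (simp add: dist_norm R_def[symmetric])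
    ultimately have "c \<le> (1 - 1 / R) * a0 + (1 / R) * r"
      by (metis ereal_less_eq(3) order_trans)
    then have "R * c \<le> (R - 1) * a0 + r" using R by (simp add: field_simps)
    then show ?thesis using k by (simp add: R_def[symmetric] algebra_simps)
  qed
  with k that show thesis by blast
qed

text \<open>The quadratic term dominates the linear minorant, so the points of the epigraph with objective at
most \<open>C\<close> lie in a compact box. Minimizing over points of the epigraph, which is closed, and not over
the domain of \<open>g\<close>, makes the objective \<open>snd u + q (fst u)\<close> a continuous real function.\<close>

lemma prox_objective_attained:
  fixes g :: "'a::euclidean_space \<Rightarrow> ereal"
  assumes g: "proper g" "closed_fun g" "convex_fun g" and \<mu>: "\<mu> > 0"
  shows "\<exists>p. \<forall>z. g p + ereal (1 / (2 * \<mu>) * (norm (v - p))\<^sup>2)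
    \<le> g z + ereal (1 / (2 * \<mu>) * (norm (v - z))\<^sup>2)"
proof -
  obtain z0 a0 where z0: "g z0 = ereal a0"
    using properE[OF g(1)] .
  obtain c k where k: "k \<ge> 0" and minor: "\<And>z r. g z \<le> ereal r \<Longrightarrow> c - k * norm (z - z0) \<le> r"
    using convex_fun_linear_minorant[OF g z0] that by metis
  define q where "q z = 1 / (2 * \<mu>) * (norm (v - z))\<^sup>2" for z
  define C e where "C = a0 + q z0" and "e = norm (v - z0)"
  \<comment> \<open>\<open>B\<close> bounds every \<open>s\<close> with \<open>s\<^sup>2 \<le> 2 \<mu> M + 2 \<mu> k s\<close>, the inequality that holds for the distance
    \<open>s\<close> from \<open>v\<close> to a point whose objective is at most \<open>C\<close>.\<close>
  define M where "M = C - c + k * e"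
  define B where "B = 2 * \<mu> * k + 2 * \<mu> * \<bar>M\<bar> + 1"
  define T where "T = (cball v B \<times> {c - k * (B + e)..C}) \<inter> ext_epigraph g"
  have q0: "q z \<ge> 0" for z using \<mu> by (simp add: q_def)
  have inT: "(z, r) \<in> T" if zr: "g z \<le> ereal r" "r + q z \<le> C" for z r
  proof -
    define s where "s = norm (v - z)"
    have R: "norm (z - z0) \<le> s + e"
      using norm_triangle_ineq[of "z - v" "v - z0"] by (simp add: s_def e_def norm_minus_commute)
    then have lo: "c - k * (s + e) \<le> r"
      using minor[OF zr(1)] k by (meson diff_left_mono mult_left_mono order_trans)
    then have "q z \<le> M + k * s" using zr(2) by (simp add: M_def algebra_simps)
    then have ss: "s\<^sup>2 \<le> 2 * \<mu> * M + 2 * \<mu> * k * s" using \<mu> by (simp add: q_def s_def field_simps)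
    have "s \<le> B"
    proof (rule ccontr)
      assume "\<not> s \<le> B"
      then have sB: "B < s" by simp
      have "B \<ge> 1" using \<mu> k by (simp add: B_def)
      then have s1: "s > 1" using sB by simp
      have "2 * \<mu> * M \<le> 2 * \<mu> * \<bar>M\<bar> * s"
      proof -
        have "2 * \<mu> * M \<le> 2 * \<mu> * \<bar>M\<bar> * 1" using \<mu> by simp
        also have "\<dots> \<le> 2 * \<mu> * \<bar>M\<bar> * s" using \<mu> s1 by (intro mult_left_mono) auto
        finally show ?thesis .
      qed
      moreover have "B * s < s * s" using sB s1 by simp
      moreover have "B * s = 2 * \<mu> * k * s + 2 * \<mu> * \<bar>M\<bar> * s + s" by (simp add: B_def algebra_simps)
      ultimately show False using ss s1 unfolding power2_eq_square by linarith
    qed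
    moreover have "c - k * (B + e) \<le> r"
      using lo \<open>s \<le> B\<close> k by (smt (verit, best) mult_left_mono)
    moreover have "r \<le> C" using zr(2) q0[of z] by simp
    ultimately show ?thesis using zr(1) by (simp add: T_def ext_epigraph_def s_def dist_norm)
  qed
  have "compact T"
    using g(2) unfolding T_def closed_fun_def by (intro compact_Int_closed compact_Times) auto
  moreover have "(z0, a0) \<in> T" by (rule inT) (auto simp: z0 C_def)
  moreover have "continuous_on T (\<lambda>u. snd u + q (fst u))"
    unfolding q_def by (intro continuous_intros)
  ultimately obtain u where u: "u \<in> T" "\<And>u'. u' \<in> T \<Longrightarrow> snd u + q (fst u) \<le> snd u' + q (fst u')"
    using continuous_attains_inf[of T "\<lambda>u. snd u + q (fst u)"] by blast
  obtain p r where pr: "u = (p, r)" by (cases u)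
  have min: "r + q p \<le> b + q z" if "g z \<le> ereal b" for z b
  proof (cases "b + q z \<le> C")
    case True
    from u(2)[OF inT[OF that this]] show ?thesis by (simp add: pr)
  next
    case False
    then show ?thesis using u(2)[OF \<open>(z0, a0) \<in> T\<close>] by (simp add: pr C_def)
  qed
  have gp: "g p \<le> ereal r" using u(1) by (simp add: T_def pr ext_epigraph_def)
  have "g p + ereal (q p) \<le> g z + ereal (q z)" for z
  proof (cases "g z = \<infinity>")
    case False
    then obtain b where b: "g z = ereal b" by (rule proper_finite[OF g(1)])
    have "g p + ereal (q p) \<le> ereal r + ereal (q p)" using gp by (rule add_right_mono)
    also have "\<dots> \<le> g z + ereal (q z)" using min[of z b] b by simp
    finally show ?thesis .
  qed simp
  then show ?thesis unfolding q_def by blast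
qed

lemma prox_le:
  fixes g :: "'a::euclidean_space \<Rightarrow> ereal"
  assumes g: "proper g" "closed_fun g" "convex_fun g" and \<mu>: "\<mu> > 0"
  shows "g (prox \<mu> g v) + ereal (1 / (2 * \<mu>) * (norm (v - prox \<mu> g v))\<^sup>2)
    \<le> g z + ereal (1 / (2 * \<mu>) * (norm (v - z))\<^sup>2)"
proof -
  define h where "h z = g z + ereal (1 / (2 * \<mu>) * (norm (v - z))\<^sup>2)" for z
  obtain p where "\<forall>z. h p \<le> h z" using prox_objective_attained[OF assms, of v] by (auto simp: h_def)
  then have "is_arg_min h (\<lambda>_. True) p" by (simp add: is_arg_min_def not_less)
  then have "is_arg_min h (\<lambda>_. True) (arg_min h (\<lambda>_. True))"
    unfolding arg_min_def by (rule someI)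
  moreover have "prox \<mu> g v = arg_min h (\<lambda>_. True)" by (simp add: prox_def h_def[abs_def])
  ultimately have "h (prox \<mu> g v) \<le> h z" by (simp add: is_arg_min_def not_less)
  then show ?thesis by (simp add: h_def)
qed

text \<open>The minimizer \<open>p\<close> is compared with the points \<open>p + s *\<^sub>R (w - p)\<close>: convexity bounds \<open>g\<close> linearly in
\<open>s\<close>, the quadratic term contributes \<open>s\<^sup>2\<close>, and the inequality of first order in \<open>s\<close> is the
subgradient inequality at \<open>w\<close>.\<close>

lemma prox_subgradient:
  fixes g :: "'a::euclidean_space \<Rightarrow> ereal"
  assumes g: "proper g" "closed_fun g" "convex_fun g" and \<mu>: "\<mu> > 0"
  shows "(1 / \<mu>) *\<^sub>R (v - prox \<mu> g v) \<in> subdifferential g (prox \<mu> g v)"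
proof -
  define p where "p = prox \<mu> g v"
  note le = prox_le[OF assms, of v, folded p_def]
  obtain z0 a0 where z0: "g z0 = ereal a0"
    using properE[OF g(1)] .
  have "g p \<noteq> \<infinity>" using le[of z0] by (auto simp: z0)
  then obtain a where a: "g p = ereal a" by (rule proper_finite[OF g(1)])
  have "g p + ereal (((1 / \<mu>) *\<^sub>R (v - p)) \<bullet> (w - p)) \<le> g w" for w
  proof (cases "g w = \<infinity>")
    case False
    then obtain b where b: "g w = ereal b" by (rule proper_finite[OF g(1)])
    define T C where "T = b - a - (1 / \<mu>) * ((v - p) \<bullet> (w - p))" and "C = (norm (w - p))\<^sup>2 / (2 * \<mu>)"
    have C: "C \<ge> 0" using \<mu> by (simp add: C_def)
    have TC: "0 \<le> T + s * C" if s: "0 < s" "s \<le> 1" for s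
    proof -
      have "(1 - s) *\<^sub>R (p, a) + s *\<^sub>R (w, b) \<in> ext_epigraph g"
        using g(3) a b s unfolding convex_fun_def by (intro convexD) (auto simp: ext_epigraph_def)
      then have "g (p + s *\<^sub>R (w - p)) \<le> ereal (a + s * (b - a))"
        by (simp add: ext_epigraph_def algebra_simps)
      then have "g (p + s *\<^sub>R (w - p)) + ereal (1 / (2 * \<mu>) * (norm (v - (p + s *\<^sub>R (w - p))))\<^sup>2)
        \<le> ereal (a + s * (b - a)) + ereal (1 / (2 * \<mu>) * (norm (v - (p + s *\<^sub>R (w - p))))\<^sup>2)"
        by (rule add_right_mono)
      from order_trans[OF le this]
      have "a + 1 / (2 * \<mu>) * (norm (v - p))\<^sup>2
        \<le> a + s * (b - a) + 1 / (2 * \<mu>) * (norm (v - (p + s *\<^sub>R (w - p))))\<^sup>2"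
        by (simp add: a)
      moreover have "(norm (v - (p + s *\<^sub>R (w - p))))\<^sup>2
        = (norm (v - p))\<^sup>2 - 2 * s * ((v - p) \<bullet> (w - p)) + s\<^sup>2 * (norm (w - p))\<^sup>2"
        unfolding diff_diff_add[symmetric] power2_norm_eq_inner inner_diff_left[of "v - p"]
          inner_diff_right[of _ "v - p"] inner_scaleR_left inner_scaleR_right
          inner_commute[of "w - p" "v - p"]
        by (simp add: power2_eq_square algebra_simps)
      ultimately have "0 \<le> s * (b - a) + 1 / (2 * \<mu>)
          * (s\<^sup>2 * (norm (w - p))\<^sup>2 - 2 * s * ((v - p) \<bullet> (w - p)))"
        by (simp add: ring_distribs)
      also have "\<dots> = s * (T + s * C)"
        using \<mu> by (simp add: T_def C_def field_simps power2_eq_square)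
      finally have "0 \<le> s * (T + s * C)" .
      then show ?thesis using s by (simp add: zero_le_mult_iff)
    qed
    have "0 \<le> T"
    proof (rule ccontr)
      assume "\<not> 0 \<le> T"
      \<comment> \<open>A step so short that the quadratic term is at most half of \<open>- T\<close>.\<close>
      define s where "s = min 1 (- T / (2 * (C + 1)))"
      have "0 < s" "s \<le> 1" using \<open>\<not> 0 \<le> T\<close> C by (auto simp: s_def divide_neg_pos)
      from TC[OF this] have "- T \<le> s * C" by simp
      also have "\<dots> \<le> - T / (2 * (C + 1)) * C" using C by (intro mult_right_mono) (auto simp: s_def)
      also have "\<dots> \<le> - T / 2" using C \<open>\<not> 0 \<le> T\<close> by (simp add: field_simps)
      finally show False using \<open>\<not> 0 \<le> T\<close> by simp
    qed
    then show ?thesis by (simp add: a b T_def algebra_simps)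
  qed simp
  then show ?thesis by (simp add: subdifferential_def p_def)
qed

lemma subdifferential_monotone:
  assumes g: "proper g" and s: "s \<in> subdifferential g p" and t: "t \<in> subdifferential g q"
  shows "0 \<le> (s - t) \<bullet> (p - q)"
proof -
  obtain z0 a0 where z0: "g z0 = ereal a0"
    using properE[OF g] .
  have fin: "g x \<noteq> \<infinity>" if "u \<in> subdifferential g x" for u x
    using that[unfolded subdifferential_def, simplified, rule_format, of z0] z0 by auto
  obtain a where a: "g p = ereal a" using fin[OF s] by (rule proper_finite[OF g])
  obtain b where b: "g q = ereal b" using fin[OF t] by (rule proper_finite[OF g])
  have "ereal a + ereal (s \<bullet> (q - p)) \<le> ereal b" "ereal b + ereal (t \<bullet> (p - q)) \<le> ereal a"
    using s t unfolding subdifferential_def a[symmetric] b[symmetric] by blast+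
  then show ?thesis by (simp add: algebra_simps inner_diff_left inner_diff_right)
qed

text \<open>The residuals \<open>(u - prox \<mu> g u) / \<mu>\<close> are subgradients, so this is monotonicity of the subdifferential
followed by the Cauchy--Schwarz inequality.\<close>

lemma prox_nonexpansive:
  fixes g :: "'a::euclidean_space \<Rightarrow> ereal"
  assumes g: "proper g" "closed_fun g" "convex_fun g" and \<mu>: "\<mu> > 0"
  shows "norm (prox \<mu> g u - prox \<mu> g v) \<le> norm (u - v)"
proof -
  define d where "d = prox \<mu> g u - prox \<mu> g v"
  have "0 \<le> ((1 / \<mu>) *\<^sub>R (u - prox \<mu> g u) - (1 / \<mu>) *\<^sub>R (v - prox \<mu> g v)) \<bullet> d"
    unfolding d_def by (intro subdifferential_monotone[OF g(1)] prox_subgradient assms)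
  also have "\<dots> = (1 / \<mu>) * ((u - v) \<bullet> d - d \<bullet> d)"
    by (simp add: d_def inner_diff_left algebra_simps diff_divide_distrib)
  finally have "d \<bullet> d \<le> (u - v) \<bullet> d" using \<mu> by (simp add: zero_le_divide_iff)
  also have "\<dots> \<le> norm (u - v) * norm d" by (rule norm_cauchy_schwarz)
  finally have "norm d * norm d \<le> norm (u - v) * norm d"
    by (simp add: dot_square_norm power2_eq_square)
  then show ?thesis unfolding d_def[symmetric] by (cases "d = 0") auto
qed

section \<open>Gradients and Hessians\<close>

lemma has_gradient_unique:
  assumes "GDERIV f x :> a" "GDERIV f x :> b"
  shows "a = (b :: 'a::real_inner)"
proof -
  have "(\<lambda>h. h \<bullet> a) = (\<lambda>h. h \<bullet> b)"
    using assms unfolding gderiv_def by (rule has_derivative_unique)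
  then show ?thesis by (metis vector_eq_ldot)
qed

lemma gradient_eqI: "GDERIV f x :> D \<Longrightarrow> gradient f x = D"
  unfolding gradient_def using has_gradient_unique by blast

lemma GDERIV_gradient:
  fixes f :: "'a::euclidean_space \<Rightarrow> real"
  assumes "f differentiable (at x)"
  shows "GDERIV f x :> gradient f x"
proof -
  obtain D where D: "(f has_derivative D) (at x)" using assms unfolding differentiable_def by blast
  define w where "w = (\<Sum>b\<in>Basis. D b *\<^sub>R b)"
  have "D h = h \<bullet> w" for h
  proof -
    have "D h = D (\<Sum>b\<in>Basis. (h \<bullet> b) *\<^sub>R b)" by (simp add: euclidean_representation)
    also have "\<dots> = (\<Sum>b\<in>Basis. (h \<bullet> b) * D b)"
      using has_derivative_linear[OF D] by (simp add: linear_sum linear_cmul)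
    finally show ?thesis by (simp add: w_def inner_sum_right mult.commute)
  qed
  then have "D = (\<lambda>h. h \<bullet> w)" by blast
  then have "GDERIV f x :> w" using D by (simp add: gderiv_def)
  then show ?thesis using gradient_eqI by metis
qed

lemma has_derivative_gradient:
  fixes f :: "real^'a \<Rightarrow> real"
  assumes "twice_differentiable f"
  shows "(gradient f has_derivative (\<lambda>h. hessian f x *v h)) (at x)"
proof -
  have "(gradient f has_derivative frechet_derivative (gradient f) (at x)) (at x)"
    using assms unfolding twice_differentiable_def frechet_derivative_works[symmetric] by blast
  moreover from has_derivative_linear[OF this]
  have "frechet_derivative (gradient f) (at x) = (\<lambda>h. hessian f x *v h)"
    by (simp add: hessian_def fun_eq_iff matrix_works)
  ultimately show ?thesis by simp
qed

lemma hessian_eqI: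
  fixes f :: "real^'a \<Rightarrow> real"
  assumes "twice_differentiable f" "(gradient f has_derivative D) (at x)"
  shows "hessian f x *v h = D h"
  using has_derivative_unique[OF has_derivative_gradient[OF assms(1)] assms(2)] by metis

text \<open>The Hessian minus \<open>mat ((m + M) / 2)\<close> has norm at most \<open>(M - m) / 2\<close>, so this is the mean value
inequality for \<open>\<lambda>x. gradient f x - ((m + M) / 2) *\<^sub>R x\<close>. Centring the spectrum in this way gives
the sharp constant.\<close>

lemma gradient_diff_le:
  fixes f :: "real^'a \<Rightarrow> real"
  assumes f: "twice_differentiable f" "\<And>\<xi>. mat m \<preceq> hessian f \<xi> \<and> hessian f \<xi> \<preceq> mat M"
  shows "norm (gradient f x - gradient f y - ((m + M) / 2) *\<^sub>R (x - y)) \<le> (M - m) / 2 * norm (x - y)"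
proof -
  define h where "h x = gradient f x - ((m + M) / 2) *\<^sub>R x" for x
  define J where "J x = hessian f x - mat ((m + M) / 2)" for x
  have "(h has_derivative (\<lambda>v. J x *v v)) (at x within UNIV)" for x
    unfolding h_def J_def matrix_vector_mult_diff_rdistrib mat_mult_vec
    by (intro derivative_intros has_derivative_gradient f)
  moreover have "onorm (\<lambda>v. J x *v v) \<le> (M - m) / 2" for x
  proof (rule onorm_le)
    fix v :: "real^'a"
    have hess: "transpose (hessian f x) = hessian f x"
      "\<And>v. m * (v \<bullet> v) \<le> v \<bullet> (hessian f x *v v)" "\<And>v. v \<bullet> (hessian f x *v v) \<le> M * (v \<bullet> v)"
      using f(2)[of x] by (auto simp: loewner_le_mat_iff)
    show "norm (J x *v v) \<le> (M - m) / 2 * norm v"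
    proof (rule symmetric_norm_le)
      show "transpose (J x) = J x"
        using hess(1) unfolding symmetric_iff_inner J_def
        by (simp add: matrix_vector_mult_diff_rdistrib mat_mult_vec inner_diff_left inner_diff_right)
      fix v :: "real^'a"
      show "\<bar>v \<bullet> (J x *v v)\<bar> \<le> (M - m) / 2 * (v \<bullet> v)"
        using hess(2,3)[of v]
        by (simp add: J_def matrix_vector_mult_diff_rdistrib mat_mult_vec inner_diff_right
            abs_le_iff field_simps)
    qed
  qed
  ultimately have "norm (h x - h y) \<le> (M - m) / 2 * norm (x - y)"
    by (intro differentiable_bound[of UNIV h "\<lambda>x v. J x *v v"]) auto
  moreover have "h x - h y = gradient f x - gradient f y - ((m + M) / 2) *\<^sub>R (x - y)"
    by (simp add: h_def scaleR_diff_right)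
  ultimately show ?thesis by simp
qed

text \<open>Expanding the square shows that this says that the gradient difference lies in the ball with centre
\<open>((m + M) / 2) *\<^sub>R (x - y)\<close> and radius \<open>(M - m) / 2 * norm (x - y)\<close>, which is
\<open>gradient_diff_le\<close>.\<close>

lemma gradient_cocoercive:
  fixes f :: "real^'a \<Rightarrow> real"
  assumes f: "twice_differentiable f" "\<And>\<xi>. mat m \<preceq> hessian f \<xi> \<and> hessian f \<xi> \<preceq> mat M"
  shows "m * M * (norm (x - y))\<^sup>2 + (norm (gradient f x - gradient f y))\<^sup>2
    \<le> (m + M) * ((gradient f x - gradient f y) \<bullet> (x - y))"
proof -
  define u d where "u = gradient f x - gradient f y" and "d = x - y"
  have "(norm (u - ((m + M) / 2) *\<^sub>R d))\<^sup>2 \<le> ((M - m) / 2 * norm d)\<^sup>2"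
    unfolding u_def d_def by (intro power_mono gradient_diff_le[OF f] norm_ge_zero)
  moreover have "(norm (u - ((m + M) / 2) *\<^sub>R d))\<^sup>2
      = (norm u)\<^sup>2 - (m + M) * (u \<bullet> d) + ((m + M) / 2)\<^sup>2 * (norm d)\<^sup>2"
    unfolding power2_norm_eq_inner inner_diff_left inner_diff_right inner_scaleR_left
      inner_scaleR_right inner_commute[of d u]
    by (simp add: power2_eq_square field_simps)
  moreover have "((m + M) / 2)\<^sup>2 * (norm d)\<^sup>2 - ((M - m) / 2 * norm d)\<^sup>2 = m * M * (norm d)\<^sup>2"
    by (simp add: power2_eq_square field_simps)
  ultimately show ?thesis unfolding u_def[symmetric] d_def[symmetric] by linarith
qed

lemma gradient_linearization_le:
  fixes f :: "real^'a \<Rightarrow> real"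
  assumes f: "twice_differentiable f" "\<And>\<xi>. mat m \<preceq> hessian f \<xi> \<and> hessian f \<xi> \<preceq> mat M"
    and m: "0 \<le> m"
  shows "norm (gradient f x - gradient f y + hessian f x *v (y - x)) \<le> 2 * M * norm (y - x)"
proof -
  have hess: "transpose (hessian f x) = hessian f x"
    "\<And>v. m * (v \<bullet> v) \<le> v \<bullet> (hessian f x *v v)" "\<And>v. v \<bullet> (hessian f x *v v) \<le> M * (v \<bullet> v)"
    using f(2)[of x] by (auto simp: loewner_le_mat_iff)
  have mM: "m \<le> M" using hess(2,3)[of "axis undefined 1"] by (simp add: inner_axis_axis)
  have "norm (hessian f x *v (y - x)) \<le> M * norm (y - x)"
  proof (rule symmetric_norm_le[OF hess(1)])
    fix v :: "real^'a"
    have "0 \<le> m * (v \<bullet> v)" using m by simp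
    then show "\<bar>v \<bullet> (hessian f x *v v)\<bar> \<le> M * (v \<bullet> v)" using hess(2,3)[of v] by linarith
  qed
  moreover have "norm (gradient f x - gradient f y) \<le> M * norm (y - x)"
  proof -
    have "norm (gradient f x - gradient f y)
      \<le> norm (gradient f x - gradient f y - ((m + M) / 2) *\<^sub>R (x - y)) + norm (((m + M) / 2) *\<^sub>R (x - y))"
      by (rule order_trans[OF _ norm_triangle_ineq]) simp
    also have "\<dots> \<le> (M - m) / 2 * norm (x - y) + (m + M) / 2 * norm (x - y)"
      using gradient_diff_le[OF f, of x y] m mM by simp
    also have "\<dots> = M * norm (y - x)" by (simp add: norm_minus_commute field_simps)
    finally show ?thesis .
  qed
  ultimately show ?thesis
    using norm_triangle_ineq[of "gradient f x - gradient f y" "hessian f x *v (y - x)"] by linarith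
qed

text \<open>Vectors over pairs of indices are handled through \<^const>\<open>block\<close> and its adjoint \<^const>\<open>embed\<close>, both
bounded linear maps; a separable function then has its derivatives blockwise.\<close>

lemma inner_blocks:
  "x \<bullet> y = (\<Sum>i\<in>UNIV. block i x \<bullet> block i y)" for x y :: "real^('b::finite \<times> 'd::finite)"
  by (simp add: inner_vec_def block_def sum.cartesian_product)

lemma block_embed: "block i (embed j w) = (if i = j then w else 0)"
  by (simp add: vec_eq_iff block_def embed_def)

lemma inner_embed: "x \<bullet> embed i w = block i x \<bullet> w"
proof -
  have "x \<bullet> embed i w = (\<Sum>j\<in>UNIV. if j = i then block j x \<bullet> w else 0)"
    unfolding inner_blocks by (intro sum.cong) (auto simp: block_embed)
  then show ?thesis by simp
qed

lemma norm_embed: "norm (embed i w) = norm w"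
  by (simp add: norm_eq_sqrt_inner inner_embed block_embed)

lemma norm_block_le: "norm (block i x) \<le> norm x"
proof -
  have "block i x \<bullet> block i x \<le> x \<bullet> x"
    unfolding inner_blocks[of x x] by (rule member_le_sum) auto
  then show ?thesis by (simp add: norm_eq_sqrt_inner)
qed

lemma bounded_linear_block: "bounded_linear (block i)"
  by (intro linear_conv_bounded_linear[THEN iffD1] linearI)
    (simp_all add: vec_eq_iff block_def)

lemma bounded_linear_embed: "bounded_linear (embed i)"
  by (intro linear_conv_bounded_linear[THEN iffD1] linearI)
    (simp_all add: vec_eq_iff embed_def)

lemma block_diff: "block i (x - y) = block i x - block i y"
  by (simp add: vec_eq_iff block_def)

lemma embed_diff: "embed i (x - y) = embed i x - embed i y"
  by (simp add: vec_eq_iff embed_def)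

lemma sep_sum_calculus:
  fixes f :: "'n::finite \<Rightarrow> real^'d::finite \<Rightarrow> real"
  assumes "\<And>i. twice_differentiable (f i)"
  shows "twice_differentiable (sep_sum f)"
    and "hessian (sep_sum f) x *v h = (\<Sum>i\<in>UNIV. embed i (hessian (f i) (block i x) *v block i h))"
proof -
  have gd: "GDERIV (sep_sum f) x :> (\<Sum>i\<in>UNIV. embed i (gradient (f i) (block i x)))" for x
  proof -
    have "((\<lambda>x. f i (block i x)) has_derivative (\<lambda>h. block i h \<bullet> gradient (f i) (block i x))) (at x)" for i
    proof -
      have "(f i has_derivative (\<lambda>h. h \<bullet> gradient (f i) (block i x))) (at (block i x))"
        using GDERIV_gradient assms unfolding gderiv_def twice_differentiable_def by blast
      from has_derivative_compose[OF bounded_linear_imp_has_derivative[OF bounded_linear_block] this]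
      show ?thesis .
    qed
    then show ?thesis
      unfolding gderiv_def sep_sum_def[abs_def] inner_sum_right inner_embed
      by (intro has_derivative_sum)
  qed
  then have grad: "gradient (sep_sum f) = (\<lambda>x. \<Sum>i\<in>UNIV. embed i (gradient (f i) (block i x)))"
    using gradient_eqI by blast
  have der: "(gradient (sep_sum f) has_derivative
      (\<lambda>h. \<Sum>i\<in>UNIV. embed i (hessian (f i) (block i x) *v block i h))) (at x)" for x
    unfolding grad
  proof (intro has_derivative_sum)
    fix i
    show "((\<lambda>x. embed i (gradient (f i) (block i x))) has_derivative
        (\<lambda>h. embed i (hessian (f i) (block i x) *v block i h))) (at x)"
      by (intro bounded_linear.has_derivative[OF bounded_linear_embed]
          has_derivative_compose[OF bounded_linear_imp_has_derivative[OF bounded_linear_block]]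
          has_derivative_gradient assms)
  qed
  show td: "twice_differentiable (sep_sum f)"
    unfolding twice_differentiable_def using gd der unfolding gderiv_def differentiable_def by blast
  show "hessian (sep_sum f) x *v h = (\<Sum>i\<in>UNIV. embed i (hessian (f i) (block i x) *v block i h))"
    using hessian_eqI[OF td der] .
qed

lemma sep_sum_hessian_bounds:
  fixes f :: "'n::finite \<Rightarrow> real^'d::finite \<Rightarrow> real"
  assumes f: "\<And>i. twice_differentiable (f i)"
    and b: "\<And>i \<xi>. mat m \<preceq> hessian (f i) \<xi> \<and> hessian (f i) \<xi> \<preceq> mat M"
  shows "mat m \<preceq> hessian (sep_sum f) x \<and> hessian (sep_sum f) x \<preceq> mat M"
proof -
  have hess: "v \<bullet> (hessian (sep_sum f) x *v w)
      = (\<Sum>i\<in>UNIV. block i v \<bullet> (hessian (f i) (block i x) *v block i w))" for v w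
    by (simp add: sep_sum_calculus(2)[OF f] inner_sum_right inner_embed)
  have sym: "transpose (hessian (f i) \<xi>) = hessian (f i) \<xi>" for i \<xi>
    using b[of i \<xi>] by (simp add: loewner_le_mat_iff)
  have "v \<bullet> (hessian (sep_sum f) x *v w) = (hessian (sep_sum f) x *v v) \<bullet> w" for v w
    unfolding hess inner_commute[of _ w]
    using sym unfolding symmetric_iff_inner by (intro sum.cong) (auto simp: inner_commute)
  then have "transpose (hessian (sep_sum f) x) = hessian (sep_sum f) x"
    by (simp add: symmetric_iff_inner)
  moreover have "m * (v \<bullet> v) \<le> v \<bullet> (hessian (sep_sum f) x *v v)"
    "v \<bullet> (hessian (sep_sum f) x *v v) \<le> M * (v \<bullet> v)" for v
    unfolding hess inner_blocks[of v v] sum_distrib_left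
    using b by (auto intro!: sum_mono simp: loewner_le_mat_iff)
  ultimately show ?thesis by (simp add: loewner_le_mat_iff)
qed

section \<open>The incidence matrix and the splitting of the Hessian\<close>

text \<open>The companion of \<^const>\<open>block\<close> that fixes the second index. A matrix \<open>A \<otimes> mat 1\<close> acts as \<open>A\<close> on each
slice, which reduces every statement about such matrices to one about \<open>A\<close>.\<close>

definition slice :: "'d \<Rightarrow> real^('b::finite \<times> 'd::finite) \<Rightarrow> real^'b"
  where "slice k x = (\<chi> i. x $ (i, k))"

lemma slice_eqI: "(\<And>k. slice k x = slice k y) \<Longrightarrow> x = y"
  by (simp add: slice_def vec_eq_iff split_paired_all)

lemma inner_slices: "x \<bullet> y = (\<Sum>k\<in>UNIV. slice k x \<bullet> slice k y)"
proof -
  have "x \<bullet> y = (\<Sum>i\<in>UNIV. \<Sum>k\<in>UNIV. x $ (i, k) * y $ (i, k))"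
    by (simp add: inner_vec_def sum.cartesian_product)
  also have "\<dots> = (\<Sum>k\<in>UNIV. slice k x \<bullet> slice k y)"
    by (subst sum.swap) (simp add: inner_vec_def slice_def)
  finally show ?thesis .
qed

lemma slice_kron_id:
  fixes A :: "real^'a::finite^'b::finite" and x :: "real^('a \<times> 'd::finite)"
  shows "slice k ((A \<otimes> mat 1) *v x) = A *v slice k x"
proof -
  have "((A \<otimes> mat 1) *v x) $ (i, k) = (\<Sum>j\<in>UNIV. A $ i $ j * x $ (j, k))" for i
  proof -
    have "((A \<otimes> mat 1) *v x) $ (i, k)
      = (\<Sum>j\<in>UNIV. \<Sum>k'\<in>UNIV. A $ i $ j * (mat 1 :: real^'d^'d) $ k $ k' * x $ (j, k'))"
      by (simp add: matrix_vector_mult_def kron_def sum.cartesian_product case_prod_unfold)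
    also have "\<dots> = (\<Sum>j\<in>UNIV. \<Sum>k'\<in>UNIV. if k = k' then A $ i $ j * x $ (j, k') else 0)"
      by (intro sum.cong refl) (simp add: mat_def)
    finally show ?thesis by simp
  qed
  then show ?thesis by (simp add: slice_def vec_eq_iff matrix_vector_mult_def)
qed

lemma transpose_kron_id:
  "transpose (A \<otimes> mat 1) = transpose A \<otimes> mat 1"
  by (simp add: kron_def transpose_def vec_eq_iff mat_def)

lemma kron_id_mult:
  fixes A :: "real^'a::finite^'b::finite" and C :: "real^'c::finite^'a"
  shows "(A \<otimes> (mat 1 :: real^'d::finite^'d)) ** (C \<otimes> mat 1) = (A ** C) \<otimes> mat 1"
proof -
  have "((A \<otimes> (mat 1 :: real^'d^'d)) ** (C \<otimes> mat 1)) *v x = ((A ** C) \<otimes> mat 1) *v x" for x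
    by (rule slice_eqI) (simp add: slice_kron_id matrix_vector_mul_assoc[symmetric])
  then show ?thesis by (simp add: matrix_eq)
qed

lemma quadratic_kron_id:
  "v \<bullet> ((A \<otimes> mat 1) *v w) = (\<Sum>k\<in>UNIV. slice k v \<bullet> (A *v slice k w))"
  by (simp add: inner_slices slice_kron_id)

lemma psd_kron_id:
  assumes "psd A"
  shows "psd (A \<otimes> (mat 1 :: real^'d::finite^'d))"
  using assms unfolding psd_def
  by (auto simp: transpose_kron_id quadratic_kron_id intro!: sum_nonneg)

text \<open>The common form, a sum of rank-one matrices over the edges, of the Laplacian and of the signless
Laplacian.\<close>

definition gram_sum :: "'e set \<Rightarrow> ('n \<Rightarrow> 'e \<Rightarrow> real) \<Rightarrow> real^'n^'n"
  where "gram_sum T a = (\<chi> i j. \<Sum>e\<in>T. a i e * a j e)"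

lemma psd_gram_sum: "psd (gram_sum T a)"
proof -
  have "0 \<le> v \<bullet> (gram_sum T a *v v)" for v
  proof -
    have "v \<bullet> (gram_sum T a *v v) = (\<Sum>i\<in>UNIV. \<Sum>j\<in>UNIV. \<Sum>e\<in>T. (v $ i * a i e) * (v $ j * a j e))"
      by (simp add: gram_sum_def inner_vec_def matrix_vector_mult_def sum_distrib_left
          sum_distrib_right mult_ac)
    also have "\<dots> = (\<Sum>i\<in>UNIV. \<Sum>e\<in>T. \<Sum>j\<in>UNIV. (v $ i * a i e) * (v $ j * a j e))"
      by (intro sum.cong refl sum.swap)
    also have "\<dots> = (\<Sum>e\<in>T. \<Sum>i\<in>UNIV. \<Sum>j\<in>UNIV. (v $ i * a i e) * (v $ j * a j e))"
      by (rule sum.swap)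
    also have "\<dots> = (\<Sum>e\<in>T. (\<Sum>i\<in>UNIV. v $ i * a i e)\<^sup>2)"
      by (simp add: power2_eq_square sum_product)
    finally show ?thesis by (simp add: sum_nonneg)
  qed
  then show ?thesis
    by (auto simp: psd_def gram_sum_def transpose_def vec_eq_iff mult.commute)
qed

lemma psd_laplacian: "psd (laplacian \<omega> src dst)"
  using psd_gram_sum[of "- {\<omega>}" "incidence src dst"] by (simp add: laplacian_def gram_sum_def)

context
  fixes E :: "'n::finite set set" and \<omega> :: "'b::finite" and src dst :: "'b \<Rightarrow> 'n"
  assumes E: "simple_graph E" "edge_numbering E \<omega> src dst"
begin

lemma edge_ends_distinct: "e \<noteq> \<omega> \<Longrightarrow> src e \<noteq> dst e"
proof
  assume "e \<noteq> \<omega>" "src e = dst e"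
  then have "{src e} \<in> E" using E(2) unfolding edge_numbering_def bij_betw_def by force
  then show False using E(1) by (auto simp: simple_graph_def)
qed

text \<open>Off the diagonal, an edge contributes a nonzero product only for its two ends, where the entries
of the incidence matrix have opposite signs.\<close>

lemma signless_laplacian_eq:
  "diag_part (laplacian \<omega> src dst) - off_part (laplacian \<omega> src dst)
    = gram_sum (- {\<omega>}) (\<lambda>i e. \<bar>incidence src dst i e\<bar>)"
proof -
  have "- (incidence src dst i e * incidence src dst j e)
      = \<bar>incidence src dst i e\<bar> * \<bar>incidence src dst j e\<bar>" if "i \<noteq> j" "e \<noteq> \<omega>" for i j e
    using that edge_ends_distinct[of e] by (auto simp: incidence_def)
  then show ?thesis
    by (auto simp: vec_eq_iff off_part_def diag_part_def laplacian_def gram_sum_def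
        sum_negf[symmetric] simp flip: abs_mult intro!: sum.cong)
qed

text \<open>The diagonal entry counts the edges at \<open>i\<close>. In a simple graph an edge at \<open>i\<close> is determined by its
other end.\<close>

lemma degree_le: "laplacian \<omega> src dst $ i $ i \<le> real CARD('n) - 1"
proof -
  define T where "T = {e \<in> - {\<omega>}. i \<in> {src e, dst e}}"
  \<comment> \<open>The end of \<open>e\<close> other than \<open>i\<close>.\<close>
  define h where "h e = (if i = src e then dst e else src e)" for e
  have "laplacian \<omega> src dst $ i $ i = (\<Sum>e\<in>- {\<omega>}. if i \<in> {src e, dst e} then 1 else 0)"
    by (simp add: laplacian_def) (intro sum.cong refl, simp add: incidence_def)
  also have "\<dots> = real (card T)" unfolding T_def by (simp add: sum.If_cases Int_def)
  also have "card T \<le> card (UNIV - {i})"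
  proof (rule card_inj_on_le)
    have "{src e, dst e} = {i, h e}" if "e \<in> T" for e
      using that by (auto simp: T_def h_def)
    moreover have "inj_on (\<lambda>e. {src e, dst e}) T"
      using E(2) unfolding edge_numbering_def bij_betw_def T_def by (auto intro: inj_on_subset)
    ultimately show "inj_on h T" unfolding inj_on_def by metis
    show "h ` T \<subseteq> UNIV - {i}" using edge_ends_distinct edge_ends_distinct[THEN not_sym]
      by (auto simp: T_def h_def)
  qed simp
  finally show ?thesis by (simp add: card_Diff_singleton of_nat_diff)
qed

text \<open>Every edge column of the incidence matrix sums to zero, so \<open>transpose B\<close> sends the vector that
repeats \<open>w\<close> in every block to \<open>embed \<omega> w\<close>. A dual update adds such a vector and an image under
\<open>transpose B\<close>, so the dual iterates stay in the column space.\<close>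

lemma embed_in_column_space:
  "embed \<omega> w \<in> span (columns (transpose (B_mat \<omega> src dst l :: real^('b \<times> 'd::finite)^('n \<times> 'd))))"
proof -
  define A :: "real^'b^'n" where "A = (\<chi> i e. if e = \<omega> then axis l 1 $ i else incidence src dst i e)"
  define x :: "real^('n \<times> 'd)" where "x = (\<chi> p. w $ snd p)"
  have col: "(\<Sum>i\<in>UNIV. A $ i $ e) = (if e = \<omega> then 1 else 0)" for e
  proof (cases "e = \<omega>")
    case True
    then show ?thesis by (simp add: A_def axis_def)
  next
    case False
    have "(\<Sum>i\<in>UNIV. A $ i $ e) = (\<Sum>i\<in>UNIV. (if i = src e then 1 else 0) - (if i = dst e then 1 else 0))"
      using False edge_ends_distinct[OF False] by (intro sum.cong) (auto simp: A_def incidence_def)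
    then show ?thesis using False by (simp add: sum_subtractf)
  qed
  have "transpose (B_mat \<omega> src dst l) *v x = embed \<omega> w"
  proof (rule slice_eqI)
    fix k
    have "(transpose A *v slice k x) $ e = (\<Sum>i\<in>UNIV. A $ i $ e) * w $ k" for e
      by (simp add: matrix_vector_mult_def transpose_def slice_def x_def sum_distrib_right
          del: transpose_matrix_vector)
    then have "transpose A *v slice k x = slice k (embed \<omega> w)"
      by (simp add: vec_eq_iff col slice_def embed_def del: transpose_matrix_vector)
    then show "slice k (transpose (B_mat \<omega> src dst l) *v x) = slice k (embed \<omega> w)"
      unfolding B_mat_def A_def[symmetric] transpose_kron_id slice_kron_id .
  qed
  then show ?thesis
    using matrix_vector_mult_in_columnspace[of "transpose (B_mat \<omega> src dst l)" x] by simp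
qed

end

lemma B_mat_embed: "B_mat \<omega> src dst l *v embed \<omega> w = embed l w"
proof (rule slice_eqI)
  fix k
  let ?A = "\<chi> i e. if e = \<omega> then axis l 1 $ i else incidence src dst i e"
  have "(?A *v slice k (embed \<omega> w)) $ i = slice k (embed l w) $ i" for i
  proof -
    have "(?A *v slice k (embed \<omega> w)) $ i
        = (\<Sum>e\<in>UNIV. (if e = \<omega> then axis l 1 $ i else incidence src dst i e)
            * (if e = \<omega> then w $ k else 0))"
      by (simp add: matrix_vector_mult_def slice_def embed_def cong: if_cong)
    also have "\<dots> = (\<Sum>e\<in>UNIV. if e = \<omega> then axis l 1 $ i * w $ k else 0)"
      by (intro sum.cong refl) simp
    finally show ?thesis by (simp add: slice_def embed_def axis_def)
  qed
  then have "?A *v slice k (embed \<omega> w) = slice k (embed l w)" by (simp add: vec_eq_iff)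
  then show "slice k (B_mat \<omega> src dst l *v embed \<omega> w) = slice k (embed l w)"
    unfolding B_mat_def slice_kron_id .
qed

lemma block_transpose_B_mat: "block \<omega> (transpose (B_mat \<omega> src dst l) *v x) = block l x"
proof -
  have "block \<omega> (transpose (B_mat \<omega> src dst l) *v x) \<bullet> w = block l x \<bullet> w" for w
  proof -
    have "block \<omega> (transpose (B_mat \<omega> src dst l) *v x) \<bullet> w
      = (transpose (B_mat \<omega> src dst l) *v x) \<bullet> embed \<omega> w"
      by (simp only: inner_embed)
    also have "\<dots> = x \<bullet> (B_mat \<omega> src dst l *v embed \<omega> w)" by (simp only: inner_matrix_transpose)
    finally show ?thesis by (simp only: B_mat_embed inner_embed)
  qed
  then show ?thesis by (metis vector_eq_rdot)
qed

lemma B_mat_nonzero: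
  "B_mat \<omega> src dst l \<noteq> (0 :: real^('b::finite \<times> 'd::finite)^('n::finite \<times> 'd))"
proof
  assume B: "B_mat \<omega> src dst l = (0 :: real^('b \<times> 'd)^('n \<times> 'd))"
  have "embed l 1 = (0 :: real^('n \<times> 'd))"
    unfolding B_mat_embed[symmetric, where \<omega> = \<omega> and src = src and dst = dst] B by simp
  then have "norm (1 :: real^'d) = 0" by (metis norm_embed norm_zero)
  then show False by simp
qed

lemma B_mat_gram:
  fixes src dst :: "'b::finite \<Rightarrow> 'n::finite"
  shows "B_mat \<omega> src dst l ** transpose (B_mat \<omega> src dst l)
    = ((\<chi> i j. axis l 1 $ i * axis l 1 $ j) + laplacian \<omega> src dst) \<otimes> (mat 1 :: real^'d::finite^'d)"
proof -
  define A :: "real^'b^'n" where "A = (\<chi> i e. if e = \<omega> then axis l 1 $ i else incidence src dst i e)"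
  have "(A ** transpose A) $ i $ j = axis l 1 $ i * axis l 1 $ j + laplacian \<omega> src dst $ i $ j" for i j
  proof -
    have "insert \<omega> (- {\<omega>}) = UNIV" by blast
    then have "(A ** transpose A) $ i $ j = (\<Sum>e\<in>insert \<omega> (- {\<omega>}). A $ i $ e * A $ j $ e)"
      by (simp add: matrix_matrix_mult_def transpose_def)
    also have "\<dots> = axis l 1 $ i * axis l 1 $ j + (\<Sum>e\<in>- {\<omega>}. A $ i $ e * A $ j $ e)"
      by (subst sum.insert) (auto simp: A_def)
    also have "(\<Sum>e\<in>- {\<omega>}. A $ i $ e * A $ j $ e) = laplacian \<omega> src dst $ i $ j"
      by (auto simp: laplacian_def A_def intro!: sum.cong)
    finally show ?thesis .
  qed
  then have "A ** transpose A = (\<chi> i j. axis l 1 $ i * axis l 1 $ j) + laplacian \<omega> src dst"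
    by (simp add: vec_eq_iff)
  then show ?thesis
    unfolding B_mat_def A_def[symmetric] transpose_kron_id kron_id_mult by simp
qed

text \<open>The splitting is exact: \<open>D - N\<close> is the regularized Hessian in \<open>x\<close> of the augmented Lagrangian.\<close>

lemma D_mat_minus_N_mat:
  fixes src dst :: "'b::finite \<Rightarrow> 'n::finite"
  shows "D_mat F (laplacian \<omega> src dst) l \<mu> \<epsilon> x - N_mat (laplacian \<omega> src dst) \<mu>
    = hessian F x + (1 / \<mu>) *\<^sub>R (B_mat \<omega> src dst l ** transpose (B_mat \<omega> src dst l)) + mat \<epsilon>"
  unfolding D_mat_def N_mat_def B_mat_gram off_part_def
  by (simp add: vec_eq_iff kron_def algebra_simps add_divide_distrib diff_divide_distrib)

text \<open>Since \<open>2 L_dia - (L_dia - L_off) = L\<close> is positive semidefinite, \<open>\<mu> N\<close> is dominated by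
\<open>2 L_dia\<close>, which also occurs in \<open>\<mu> D\<close>. The contraction factor is the largest value of
\<open>2 k / (\<mu> (m + \<epsilon>) + 2 k)\<close> over vertex degrees \<open>k \<le> q\<close>.\<close>

lemma D_mat_N_mat_bounds:
  fixes E :: "'n::finite set set" and \<omega> :: "'b::finite" and src dst :: "'b \<Rightarrow> 'n"
    and l :: 'n and F :: "real^('n \<times> 'd::finite) \<Rightarrow> real"
  assumes E: "simple_graph E" "edge_numbering E \<omega> src dst"
    and H: "mat m \<preceq> hessian F x" "hessian F x \<preceq> mat M"
    and pos: "0 < m" "0 < \<mu>" "0 < \<epsilon>"
  defines "D \<equiv> D_mat F (laplacian \<omega> src dst) l \<mu> \<epsilon> x" and "N \<equiv> N_mat (laplacian \<omega> src dst) \<mu>"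
    and "q \<equiv> real CARD('n) - 1"
  shows "transpose D = D"
    and "(m + \<epsilon>) * (v \<bullet> v) \<le> v \<bullet> (D *v v)"
    and "v \<bullet> (D *v v) \<le> (M + \<epsilon> + (1 + 2 * q) / \<mu>) * (v \<bullet> v)"
    and "psd N"
    and "v \<bullet> (N *v v) \<le> 2 * q / (\<mu> * (m + \<epsilon>) + 2 * q) * (v \<bullet> (D *v v))"
proof -
  define L where "L = laplacian \<omega> src dst"
  define P :: "real^'n^'n" where "P = (\<chi> i j. axis l 1 $ i * axis l 1 $ j)"
  define I :: "real^'d^'d" where "I = mat 1"
  have q: "q \<ge> 0" by (simp add: q_def Suc_leI)
  have D_eq: "D = hessian F x + (1 / \<mu>) *\<^sub>R (P \<otimes> I) + (2 / \<mu>) *\<^sub>R (diag_part L \<otimes> I) + mat \<epsilon>"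
    by (simp add: D_def D_mat_def P_def L_def I_def)
  have symH: "transpose (hessian F x) = hessian F x" using H by (simp add: loewner_le_mat_iff)
  have Pv: "a \<bullet> (P *v c) = a $ l * c $ l" for a c
  proof -
    have "P *v c = (c $ l) *\<^sub>R axis l 1"
    proof -
      have "(P *v c) $ i = (\<Sum>j\<in>UNIV. if j = l then axis l 1 $ i * c $ j else 0)" for i
        unfolding matrix_vector_mult_def P_def vec_lambda_beta
          by (intro sum.cong refl) (simp add: axis_def)
      then show ?thesis by (simp add: vec_eq_iff)
    qed
    then show ?thesis by (simp add: inner_axis)
  qed
  have dv: "a \<bullet> (diag_part L *v c) = (\<Sum>i\<in>UNIV. L $ i $ i * (a $ i * c $ i))" for a c
  proof -
    have "(diag_part L *v c) $ i = (\<Sum>j\<in>UNIV. if j = i then L $ i $ i * c $ i else 0)" for i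
      unfolding matrix_vector_mult_def diag_part_def vec_lambda_beta
      by (intro sum.cong refl) simp
    then show ?thesis by (simp add: inner_vec_def mult.left_commute)
  qed
  have symP: "transpose (P \<otimes> I) = P \<otimes> I" and symd: "transpose (diag_part L \<otimes> I) = diag_part L \<otimes> I"
    by (auto simp: I_def P_def diag_part_def transpose_def vec_eq_iff kron_def mat_def)
  show "transpose D = D"
    using symH symP symd unfolding symmetric_iff_inner D_eq
    by (simp add: matrix_vector_mult_add_rdistrib inner_add_left inner_add_right mat_mult_vec
        scaleR_matrix_vector_assoc[symmetric])
  define p where "p = v \<bullet> ((P \<otimes> I) *v v)"
  define d where "d = v \<bullet> ((diag_part L \<otimes> I) *v v)"
  define h where "h = v \<bullet> (hessian F x *v v)"
  have quadD: "v \<bullet> (D *v v) = h + p / \<mu> + 2 / \<mu> * d + \<epsilon> * (v \<bullet> v)"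
    by (simp add: D_eq matrix_vector_mult_add_rdistrib inner_add_right mat_mult_vec p_def d_def h_def
        scaleR_matrix_vector_assoc[symmetric])
  have h: "m * (v \<bullet> v) \<le> h" "h \<le> M * (v \<bullet> v)"
    using H by (auto simp: h_def loewner_le_mat_iff)
  have p: "0 \<le> p" "p \<le> v \<bullet> v"
  proof -
    have p_eq: "p = (\<Sum>k\<in>UNIV. (slice k v $ l)\<^sup>2)"
      by (simp add: p_def I_def quadratic_kron_id Pv power2_eq_square)
    then show "0 \<le> p" by (simp add: sum_nonneg)
    have "(slice k v $ l)\<^sup>2 \<le> slice k v \<bullet> slice k v" for k
      unfolding inner_vec_def power2_eq_square inner_real_def
      by (rule member_le_sum) auto
    then show "p \<le> v \<bullet> v" unfolding p_eq inner_slices[of v v] by (intro sum_mono)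
  qed
  have d: "0 \<le> d" "d \<le> q * (v \<bullet> v)"
  proof -
    have d_eq: "d = (\<Sum>k\<in>UNIV. \<Sum>i\<in>UNIV. L $ i $ i * (slice k v $ i * slice k v $ i))"
      by (simp add: d_def I_def quadratic_kron_id dv)
    have "0 \<le> L $ i $ i" for i by (simp add: L_def laplacian_def sum_nonneg)
    then show "0 \<le> d" unfolding d_eq by (intro sum_nonneg mult_nonneg_nonneg[OF _ zero_le_square])
    show "d \<le> q * (v \<bullet> v)"
      unfolding d_eq inner_slices[of v v] sum_distrib_left
    proof (rule sum_mono)
      fix k
      show "(\<Sum>i\<in>UNIV. L $ i $ i * (slice k v $ i * slice k v $ i)) \<le> q * (slice k v \<bullet> slice k v)"
        unfolding inner_vec_def sum_distrib_left inner_real_def q_def L_def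
        by (intro sum_mono mult_right_mono degree_le[OF E]) auto
    qed
  qed
  have "0 \<le> p / \<mu>" "0 \<le> 2 / \<mu> * d" using p d pos by auto
  then have ge: "(m + \<epsilon>) * (v \<bullet> v) + 2 / \<mu> * d \<le> v \<bullet> (D *v v)"
    and "(m + \<epsilon>) * (v \<bullet> v) \<le> v \<bullet> (D *v v)"
    using h(1) unfolding quadD distrib_right by linarith+
  then show "(m + \<epsilon>) * (v \<bullet> v) \<le> v \<bullet> (D *v v)" by blast
  have "p / \<mu> \<le> (v \<bullet> v) / \<mu>" "2 / \<mu> * d \<le> 2 / \<mu> * (q * (v \<bullet> v))"
    using p d pos by (auto intro: divide_right_mono)
  then show "v \<bullet> (D *v v) \<le> (M + \<epsilon> + (1 + 2 * q) / \<mu>) * (v \<bullet> v)"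
    using h by (simp add: quadD distrib_right add_divide_distrib)
  have "psd (diag_part L - off_part L)"
    unfolding L_def signless_laplacian_eq[OF E] by (rule psd_gram_sum)
  then have psd: "psd ((diag_part L - off_part L) \<otimes> I)" unfolding I_def by (rule psd_kron_id)
  then show "psd N"
    using pos unfolding psd_def symmetric_iff_inner N_def N_mat_def L_def[symmetric] I_def[symmetric]
    by (auto simp: scaleR_matrix_vector_assoc[symmetric])
  have "0 \<le> v \<bullet> ((L \<otimes> I) *v v)"
    using psd_kron_id[OF psd_laplacian] unfolding psd_def L_def I_def by blast
  moreover have "L \<otimes> I = 2 *\<^sub>R (diag_part L \<otimes> I) - (diag_part L - off_part L) \<otimes> I"
    by (simp add: off_part_def kron_def vec_eq_iff algebra_simps)
  ultimately have "v \<bullet> (((diag_part L - off_part L) \<otimes> I) *v v) \<le> 2 * d"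
    by (simp add: d_def matrix_vector_mult_diff_rdistrib inner_diff_right
        scaleR_matrix_vector_assoc[symmetric])
  then have "v \<bullet> (N *v v) \<le> 2 / \<mu> * d"
    using pos by (simp add: N_def N_mat_def L_def I_def scaleR_matrix_vector_assoc[symmetric]
        divide_right_mono)
  also have "\<dots> \<le> 2 * q / (\<mu> * (m + \<epsilon>) + 2 * q) * ((m + \<epsilon>) * (v \<bullet> v) + 2 / \<mu> * d)"
  proof -
    define c where "c = \<mu> * (m + \<epsilon>)"
    have c: "c > 0" using pos by (simp add: c_def)
    have "c * d \<le> c * (q * (v \<bullet> v))" using d c by (intro mult_left_mono) auto
    then have "d \<le> q / (c + 2 * q) * (c * (v \<bullet> v) + 2 * d)"
      using c q by (simp add: field_simps)
    then have "2 / \<mu> * d \<le> 2 / \<mu> * (q / (c + 2 * q) * (c * (v \<bullet> v) + 2 * d))"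
      using pos by (intro mult_left_mono) auto
    also have "\<dots> = 2 * q / (c + 2 * q) * ((m + \<epsilon>) * (v \<bullet> v) + 2 / \<mu> * d)"
      using pos c q by (simp add: c_def field_simps)
    finally show ?thesis by (simp add: c_def)
  qed
  also have "\<dots> \<le> 2 * q / (\<mu> * (m + \<epsilon>) + 2 * q) * (v \<bullet> (D *v v))"
    using ge q pos by (intro mult_left_mono) auto
  finally show "v \<bullet> (N *v v) \<le> 2 * q / (\<mu> * (m + \<epsilon>) + 2 * q) * (v \<bullet> (D *v v))" .
qed

section \<open>Linear convergence\<close>

lemma norm_add_square_le:
  fixes a b :: "'a::real_inner"
  assumes "c > 1"
  shows "(norm (a + b))\<^sup>2 \<le> c * (norm a)\<^sup>2 + c / (c - 1) * (norm b)\<^sup>2"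
proof -
  have "0 \<le> (norm ((c - 1) *\<^sub>R a - b))\<^sup>2" by simp
  also have "\<dots> = (c - 1)\<^sup>2 * (norm a)\<^sup>2 - 2 * (c - 1) * (a \<bullet> b) + (norm b)\<^sup>2"
    unfolding power2_norm_eq_inner inner_diff_left inner_diff_right inner_scaleR_left
      inner_scaleR_right inner_commute[of b a]
    by (simp add: power2_eq_square algebra_simps)
  finally have "2 * (a \<bullet> b) \<le> (c - 1) * (norm a)\<^sup>2 + 1 / (c - 1) * (norm b)\<^sup>2"
    using assms by (simp add: field_simps power2_eq_square)
  moreover have "(norm (a + b))\<^sup>2 = (norm a)\<^sup>2 + 2 * (a \<bullet> b) + (norm b)\<^sup>2"
    unfolding power2_norm_eq_inner inner_add_left inner_add_right inner_commute[of b a] by simp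
  moreover have "c / (c - 1) = 1 + 1 / (c - 1)" using assms by (simp add: field_simps)
  ultimately show ?thesis by (simp add: algebra_simps)
qed

text \<open>The inequality behind the theorem, free of graphs and iterations. Here \<open>a\<close> and \<open>b\<close> are the new
primal and dual errors, \<open>s\<close> and \<open>r\<close> the steps just made, \<open>u\<close> the difference of the gradients,
\<open>w\<close> the image of \<open>b\<close> under the constraint matrix, and \<open>e\<close> the inexactness of the primal step.
Testing the stationarity equation with \<open>a\<close> gives the descent inequality, whose left-hand side contains
the surplus \<open>(2 m M / (m + M) - 1 / \<zeta>) |a|\<^sup>2 + (\<epsilon> - \<zeta> \<gamma>\<^sup>2) |s|\<^sup>2 + 2 / (m + M) |u|\<^sup>2\<close>. The first term pays
for \<open>\<delta> \<epsilon> |a|\<^sup>2\<close>. The others pay for \<open>\<delta> \<mu> |b|\<^sup>2\<close>, because \<open>|b|\<^sup>2\<close> is bounded by \<open>|w|\<^sup>2\<close> and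
\<open>w = - (u + e + \<epsilon> s)\<close>; the parameters \<open>\<beta>\<close> and \<open>\<eta>\<close> weight the two splittings of this sum. The three
terms of the minimum that defines \<open>\<delta>\<close> are these requirements for \<open>|a|\<^sup>2\<close>, \<open>|s|\<^sup>2\<close> and \<open>|u|\<^sup>2\<close>.\<close>

lemma inexact_step_contraction:
  fixes a s u e w :: "'a::real_inner" and b r :: "'b::real_inner"
  assumes stat: "u + w + \<epsilon> *\<^sub>R s + e = 0"
    and co: "m * M * (norm a)\<^sup>2 + (norm u)\<^sup>2 \<le> (m + M) * (u \<bullet> a)"
    and dual: "\<mu> * (b \<bullet> r) \<le> w \<bullet> a"
    and err: "norm e \<le> \<gamma> * norm s"
    and range: "\<kappa> * (norm b)\<^sup>2 \<le> (norm w)\<^sup>2"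
    and pos: "0 < m" "0 < M" "0 < \<mu>" "0 < \<epsilon>" "0 < \<zeta>" "0 < \<kappa>" "1 < \<beta>" "1 < \<eta>" "0 \<le> \<delta>"
    and \<delta>: "\<delta> \<le> 2 * m * M / (\<epsilon> * (m + M)) - 1 / (\<epsilon> * \<zeta>)"
      "\<delta> \<le> (\<epsilon> - \<zeta> * \<gamma>\<^sup>2) * \<kappa> * (\<beta> - 1) * (\<eta> - 1)
        / (\<mu> * \<beta> * (\<epsilon>\<^sup>2 * (\<eta> - 1) + \<eta> * \<gamma>\<^sup>2 * (\<beta> - 1)))"
      "\<delta> \<le> 2 * \<kappa> / ((m + M) * \<mu> * \<beta> * \<eta>)"
  shows "(1 + \<delta>) * (\<epsilon> * (norm a)\<^sup>2 + \<mu> * (norm b)\<^sup>2)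
    \<le> \<epsilon> * (norm (a - s))\<^sup>2 + \<mu> * (norm (b - r))\<^sup>2"
proof -
  define S where "S = m + M"
  have S: "S > 0" using pos by (simp add: S_def)
  have err2: "(norm e)\<^sup>2 \<le> \<gamma>\<^sup>2 * (norm s)\<^sup>2"
    using power_mono[OF err, of 2] by (simp add: power_mult_distrib)
  have young: "- 2 * (e \<bullet> a) \<le> \<zeta> * (norm e)\<^sup>2 + 1 / \<zeta> * (norm a)\<^sup>2"
  proof -
    have "0 \<le> (norm (\<zeta> *\<^sub>R e + a))\<^sup>2" by simp
    also have "\<dots> = \<zeta>\<^sup>2 * (norm e)\<^sup>2 + 2 * \<zeta> * (e \<bullet> a) + (norm a)\<^sup>2"
      unfolding power2_norm_eq_inner inner_add_left inner_add_right inner_scaleR_left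
        inner_scaleR_right inner_commute[of a e]
      by (simp add: power2_eq_square algebra_simps)
    finally show ?thesis using pos by (simp add: field_simps power2_eq_square)
  qed
  have "(u + w + \<epsilon> *\<^sub>R s + e) \<bullet> a = 0" by (simp only: stat inner_zero_left)
  then have stat_a: "u \<bullet> a + w \<bullet> a + \<epsilon> * (s \<bullet> a) + e \<bullet> a = 0" by (simp only: inner_add_left inner_scaleR_left)
  have as: "2 * (s \<bullet> a) = (norm s)\<^sup>2 + (norm a)\<^sup>2 - (norm (a - s))\<^sup>2"
    and br: "2 * (b \<bullet> r) = (norm r)\<^sup>2 + (norm b)\<^sup>2 - (norm (b - r))\<^sup>2"
    unfolding power2_norm_eq_inner inner_diff_left inner_diff_right inner_commute[of a s]
      inner_commute[of r b] by simp_all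
  have "2 * m * M / S * (norm a)\<^sup>2 + 2 / S * (norm u)\<^sup>2 \<le> 2 * (u \<bullet> a)"
  proof -
    have "2 * m * M / S * (norm a)\<^sup>2 + 2 / S * (norm u)\<^sup>2 = 2 / S * (m * M * (norm a)\<^sup>2 + (norm u)\<^sup>2)"
      using S by (simp add: field_simps)
    also have "\<dots> \<le> 2 / S * (S * (u \<bullet> a))"
      using co S unfolding S_def[symmetric] by (intro mult_left_mono) auto
    finally show ?thesis using S by simp
  qed
  also have "\<dots> = - 2 * (w \<bullet> a) - \<epsilon> * (2 * (s \<bullet> a)) - 2 * (e \<bullet> a)"
    using stat_a by simp
  also have "\<dots> \<le> - \<mu> * (2 * (b \<bullet> r)) - \<epsilon> * (2 * (s \<bullet> a)) + (\<zeta> * (norm e)\<^sup>2 + 1 / \<zeta> * (norm a)\<^sup>2)"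
    using dual young by simp
  also have "\<dots> \<le> - \<mu> * (2 * (b \<bullet> r)) - \<epsilon> * (2 * (s \<bullet> a))
      + (\<zeta> * (\<gamma>\<^sup>2 * (norm s)\<^sup>2) + 1 / \<zeta> * (norm a)\<^sup>2)"
    using err2 pos by simp
  finally have descent: "\<epsilon> * (norm a)\<^sup>2 + \<mu> * (norm b)\<^sup>2 + (2 * m * M / S - 1 / \<zeta>) * (norm a)\<^sup>2
      + (\<epsilon> - \<zeta> * \<gamma>\<^sup>2) * (norm s)\<^sup>2 + 2 / S * (norm u)\<^sup>2 + \<mu> * (norm r)\<^sup>2
      \<le> \<epsilon> * (norm (a - s))\<^sup>2 + \<mu> * (norm (b - r))\<^sup>2"
    unfolding as br by (simp add: algebra_simps)
  define C where "C = \<beta> * \<eta> / (\<eta> - 1) * \<gamma>\<^sup>2 + \<beta> / (\<beta> - 1) * \<epsilon>\<^sup>2"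
  have C: "C > 0"
    unfolding C_def using pos by (intro add_nonneg_pos) (auto intro!: mult_nonneg_nonneg mult_pos_pos)
  have wb: "\<kappa> * (norm b)\<^sup>2 \<le> \<beta> * \<eta> * (norm u)\<^sup>2 + C * (norm s)\<^sup>2"
  proof -
    have "w = - ((u + e) + \<epsilon> *\<^sub>R s)" using stat by (simp add: algebra_simps eq_neg_iff_add_eq_0)
    then have "\<kappa> * (norm b)\<^sup>2 \<le> (norm ((u + e) + \<epsilon> *\<^sub>R s))\<^sup>2"
      using range by (simp only: norm_minus_cancel)
    also have "\<dots> \<le> \<beta> * (norm (u + e))\<^sup>2 + \<beta> / (\<beta> - 1) * (norm (\<epsilon> *\<^sub>R s))\<^sup>2"
      using pos by (intro norm_add_square_le)
    also have "\<dots> \<le> \<beta> * (\<eta> * (norm u)\<^sup>2 + \<eta> / (\<eta> - 1) * (\<gamma>\<^sup>2 * (norm s)\<^sup>2))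
        + \<beta> / (\<beta> - 1) * (norm (\<epsilon> *\<^sub>R s))\<^sup>2"
      using pos by (intro add_right_mono mult_left_mono order_trans[OF norm_add_square_le[of \<eta>]]
          add_left_mono err2) auto
    also have "\<dots> = \<beta> * \<eta> * (norm u)\<^sup>2 + C * (norm s)\<^sup>2"
      by (simp add: C_def power_mult_distrib algebra_simps)
    finally show ?thesis .
  qed
  have "\<delta> * \<mu> * (\<beta> * \<eta>) \<le> 2 / S * \<kappa>"
  proof -
    have "\<delta> * (S * \<mu> * \<beta> * \<eta>) \<le> 2 * \<kappa>"
      using \<delta>(3)[folded S_def] pos S by (simp add: pos_le_divide_eq)
    then show ?thesis using S by (simp add: pos_le_divide_eq mult_ac)
  qed
  then have du: "\<delta> * \<mu> * (\<beta> * \<eta> * (norm u)\<^sup>2) \<le> \<kappa> * (2 / S * (norm u)\<^sup>2)"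
    using mult_right_mono[of "\<delta> * \<mu> * (\<beta> * \<eta>)" "2 / S * \<kappa>" "(norm u)\<^sup>2"] by (simp add: mult_ac)
  have C_eq: "\<mu> * C = \<mu> * \<beta> * (\<epsilon>\<^sup>2 * (\<eta> - 1) + \<eta> * \<gamma>\<^sup>2 * (\<beta> - 1)) / ((\<beta> - 1) * (\<eta> - 1))"
    using pos by (simp add: C_def field_simps)
  have "\<delta> \<le> (\<epsilon> - \<zeta> * \<gamma>\<^sup>2) * \<kappa> / (\<mu> * C)"
    using \<delta>(2) unfolding C_eq by (simp add: mult.assoc)
  then have "\<delta> * \<mu> * C \<le> \<kappa> * (\<epsilon> - \<zeta> * \<gamma>\<^sup>2)"
    using C pos by (simp add: field_simps)
  then have ds: "\<delta> * \<mu> * (C * (norm s)\<^sup>2) \<le> \<kappa> * ((\<epsilon> - \<zeta> * \<gamma>\<^sup>2) * (norm s)\<^sup>2)"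
    using mult_right_mono[of "\<delta> * \<mu> * C" "\<kappa> * (\<epsilon> - \<zeta> * \<gamma>\<^sup>2)" "(norm s)\<^sup>2"] by (simp add: mult.assoc)
  have "\<kappa> * (\<delta> * \<mu> * (norm b)\<^sup>2) = \<delta> * \<mu> * (\<kappa> * (norm b)\<^sup>2)" by simp
  also have "\<dots> \<le> \<delta> * \<mu> * (\<beta> * \<eta> * (norm u)\<^sup>2 + C * (norm s)\<^sup>2)"
    using wb pos by (intro mult_left_mono) auto
  also have "\<dots> \<le> \<kappa> * (2 / S * (norm u)\<^sup>2 + (\<epsilon> - \<zeta> * \<gamma>\<^sup>2) * (norm s)\<^sup>2)"
    using du ds by (simp add: distrib_left)
  finally have db: "\<delta> * \<mu> * (norm b)\<^sup>2 \<le> 2 / S * (norm u)\<^sup>2 + (\<epsilon> - \<zeta> * \<gamma>\<^sup>2) * (norm s)\<^sup>2"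
    using pos by simp
  have "\<delta> * \<epsilon> \<le> 2 * m * M / S - 1 / \<zeta>"
    using mult_right_mono[OF \<delta>(1), of \<epsilon>] pos S by (simp add: S_def[symmetric] left_diff_distrib)
  then have da: "\<delta> * \<epsilon> * (norm a)\<^sup>2 \<le> (2 * m * M / S - 1 / \<zeta>) * (norm a)\<^sup>2"
    by (rule mult_right_mono) simp
  have "0 \<le> \<mu> * (norm r)\<^sup>2" using pos by simp
  then show ?thesis using descent da db by (simp add: distrib_left distrib_right)
qed

lemma sqnorm_wrt_weight_stack:
  "sqnorm_wrt (weight_mat \<epsilon> \<mu>) (stack a b - stack a' b')
    = \<epsilon> * (norm (a - a'))\<^sup>2 + \<mu> * (norm (b - b'))\<^sup>2"
proof -
  have W: "(weight_mat \<epsilon> \<mu> *v v) $ p = (case p of Inl _ \<Rightarrow> \<epsilon> | Inr _ \<Rightarrow> \<mu>) * v $ p" for v p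
    by (simp add: matrix_vector_mult_def weight_mat_def if_distrib if_distribR cong: if_cong)
  show ?thesis
    unfolding sqnorm_wrt_def inner_vec_def W UNIV_Plus_UNIV[symmetric] power2_norm_eq_inner
    by (subst sum.Plus) (simp_all add: stack_def sum_distrib_left mult_ac)
qed

lemma DN_ADMM_dual_range:
  fixes src dst :: "'b::finite \<Rightarrow> 'n::finite"
    and x :: "nat \<Rightarrow> real^('n \<times> 'd::finite)"
  assumes E: "simple_graph E" "edge_numbering E \<omega> src dst"
    and iter: "DN_ADMM K \<mu> \<epsilon> F g \<omega> src dst l x z y" "y 0 = 0"
  shows "y t \<in> span (columns (transpose (B_mat \<omega> src dst l :: real^('b \<times> 'd)^('n \<times> 'd))))"
proof (induction t)
  case 0
  then show ?case by (simp add: iter(2) span_zero)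
next
  case (Suc t)
  obtain w where y: "y (Suc t) = y t
      + (1 / \<mu>) *\<^sub>R (transpose (B_mat \<omega> src dst l) *v x (Suc t) - embed \<omega> w)"
    using iter(1) unfolding DN_ADMM_def Let_def by metis
  show ?case
    unfolding y by (intro span_add span_scale span_diff Suc embed_in_column_space[OF E]
        matrix_vector_mult_in_columnspace)
qed

text \<open>The iterates satisfy the stationarity condition up to \<open>\<epsilon> *\<^sub>R s\<close>, with an error proportional to the
step \<open>s\<close>. The error has three sources, one for each term of the constant: the gradient is
linearized at the old point, the proximal operator is evaluated there too (it is nonexpansive),
and the Newton system is solved by a truncated series.\<close>

lemma DN_ADMM_primal_residual:
  fixes E :: "'n::finite set set" and \<omega> :: "'b::finite" and src dst :: "'b \<Rightarrow> 'n"
    and F :: "real^('n \<times> 'd::finite) \<Rightarrow> real" and g :: "real^'d \<Rightarrow> ereal"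
    and t :: nat
  assumes E: "simple_graph E" "edge_numbering E \<omega> src dst"
    and F: "twice_differentiable F" "\<And>\<xi>. mat m \<preceq> hessian F \<xi> \<and> hessian F \<xi> \<preceq> mat M"
    and g: "proper g" "closed_fun g" "convex_fun g"
    and pos: "0 < m" "0 < \<mu>" "0 < \<epsilon>"
    and iter: "DN_ADMM K \<mu> \<epsilon> F g \<omega> src dst l x z y"
  defines "q \<equiv> real CARD('n) - 1" and "s \<equiv> x (Suc t) - x t"
  shows "norm (gradient F (x (Suc t)) + B_mat \<omega> src dst l *v y (Suc t) + \<epsilon> *\<^sub>R s)
    \<le> (2 * M + 1 / \<mu> + (M + \<epsilon> + (1 + 2 * q) / \<mu>)
        * (2 * q / (\<mu> * (m + \<epsilon>) + 2 * q)) ^ (K + 1)) * norm s"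
proof -
  define B :: "real^('b \<times> 'd)^('n \<times> 'd)" where "B = B_mat \<omega> src dst l"
  define D where "D = D_mat F (laplacian \<omega> src dst) l \<mu> \<epsilon> (x t)"
  define N :: "real^('n \<times> 'd)^('n \<times> 'd)" where "N = N_mat (laplacian \<omega> src dst) \<mu>"
  define v where "v = block l (x t) + \<mu> *\<^sub>R block \<omega> (y t)"
  define v' where "v' = block l (x (Suc t)) + \<mu> *\<^sub>R block \<omega> (y t)"
  define \<theta> where "\<theta> = embed \<omega> (prox \<mu> g v)"
  define r where "r = gradient F (x t) + (1 / \<mu>) *\<^sub>R (B *v (transpose B *v x t - \<theta>)) + B *v y t"
  define H where "H = hessian F (x t)"
  have x: "x (Suc t) = x t - H_inv D N K *v r"
    and z: "z (Suc t) = embed \<omega> (prox \<mu> g v')"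
    and y: "y (Suc t) = y t + (1 / \<mu>) *\<^sub>R (transpose B *v x (Suc t) - z (Suc t))"
    using iter unfolding DN_ADMM_def Let_def B_def D_def N_def v_def v'_def \<theta>_def r_def by blast+
  have s: "H_inv D N K *v r = - s" by (simp add: s_def x)
  \<comment> \<open>Errors of the truncated series, of the linearization and of the early proximal step.\<close>
  have split: "gradient F (x (Suc t)) + B *v y (Suc t) + \<epsilon> *\<^sub>R s
      = (r - (D - N) *v (H_inv D N K *v r))
        - (gradient F (x t) - gradient F (x (Suc t)) + H *v (x (Suc t) - x t))
        + (1 / \<mu>) *\<^sub>R (B *v (\<theta> - z (Suc t)))"
  proof -
    have DN: "(D - N) *v (- s) = - (H *v s + (1 / \<mu>) *\<^sub>R (B *v (transpose B *v s)) + \<epsilon> *\<^sub>R s)"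
      unfolding D_def N_def D_mat_minus_N_mat B_def H_def
      by (simp add: matrix_vector_mult_add_rdistrib mat_mult_vec scaleR_matrix_vector_assoc[symmetric]
          matrix_vector_mul_assoc linear_neg[OF matrix_vector_mul_linear]
          del: transpose_matrix_vector)
    have "transpose B *v s = transpose B *v x (Suc t) - transpose B *v x t"
      unfolding s_def by (rule matrix_vector_mult_diff_distrib)
    then show ?thesis
      unfolding s DN unfolding y r_def s_def[symmetric]
      by (simp add: matrix_vector_right_distrib matrix_vector_mult_diff_distrib
          matrix_vector_mult_scaleR scaleR_diff_right scaleR_add_right del: transpose_matrix_vector)
  qed
  have newton: "norm (r - (D - N) *v (H_inv D N K *v r))
      \<le> (M + \<epsilon> + (1 + 2 * q) / \<mu>) * (2 * q / (\<mu> * (m + \<epsilon>) + 2 * q)) ^ Suc K * norm s"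
  proof -
    note hess = F(2)[of "x t", THEN conjunct1] F(2)[of "x t", THEN conjunct2]
    have "norm (r - (D - N) *v (H_inv D N K *v r))
        \<le> (M + \<epsilon> + (1 + 2 * q) / \<mu>) * (2 * q / (\<mu> * (m + \<epsilon>) + 2 * q)) ^ Suc K
          * norm (H_inv D N K *v r)"
    proof (rule H_inv_residual[where c = "m + \<epsilon>"])
      show "0 < m + \<epsilon>" using pos by simp
    qed (unfold D_def N_def q_def, (rule D_mat_N_mat_bounds[OF E hess pos])+)
    then show ?thesis by (simp add: s)
  qed
  have lin: "norm (gradient F (x t) - gradient F (x (Suc t)) + H *v (x (Suc t) - x t)) \<le> 2 * M * norm s"
    unfolding H_def s_def using gradient_linearization_le[OF F] pos(1) by simp
  have prox: "norm ((1 / \<mu>) *\<^sub>R (B *v (\<theta> - z (Suc t)))) \<le> 1 / \<mu> * norm s"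
  proof -
    have "norm (B *v (\<theta> - z (Suc t))) = norm (prox \<mu> g v - prox \<mu> g v')"
      by (simp add: \<theta>_def z B_def B_mat_embed norm_embed flip: embed_diff)
    also have "\<dots> \<le> norm (v - v')" by (rule prox_nonexpansive[OF g pos(2)])
    also have "v - v' = - block l s" by (simp add: v_def v'_def s_def block_diff)
    also have "norm (- block l s) \<le> norm s" by (simp add: norm_block_le)
    finally show ?thesis using pos by (simp add: divide_right_mono)
  qed
  have "norm (gradient F (x (Suc t)) + B *v y (Suc t) + \<epsilon> *\<^sub>R s)
    \<le> (M + \<epsilon> + (1 + 2 * q) / \<mu>) * (2 * q / (\<mu> * (m + \<epsilon>) + 2 * q)) ^ Suc K * norm s
      + 2 * M * norm s + 1 / \<mu> * norm s"
    unfolding split by (intro order_trans[OF norm_triangle_ineq] order_trans[OF norm_triangle_ineq4]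
        add_mono newton lin prox)
  then show ?thesis unfolding B_def by (simp only: Suc_eq_plus1 distrib_right)
qed

text \<open>The last block of the new dual iterate is the residual of a proximal step, hence a subgradient of
\<open>g\<close> at the new \<open>z\<close>. Monotonicity against the optimal subgradient makes \<open>z\<close> drop out of the
estimate.\<close>

lemma DN_ADMM_dual_step:
  fixes \<omega> :: "'b::finite" and src dst :: "'b \<Rightarrow> 'n::finite"
    and F :: "real^('n \<times> 'd::finite) \<Rightarrow> real" and g :: "real^'d \<Rightarrow> ereal"
  assumes g: "proper g" "closed_fun g" "convex_fun g" and \<mu>: "0 < \<mu>"
    and iter: "DN_ADMM K \<mu> \<epsilon> F g \<omega> src dst l x z y"
    and opt: "KKT F g \<omega> (B_mat \<omega> src dst l) xs zs ys"
  shows "\<mu> * ((y (Suc t) - ys) \<bullet> (y (Suc t) - y t))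
    \<le> (B_mat \<omega> src dst l *v (y (Suc t) - ys)) \<bullet> (x (Suc t) - xs)"
proof -
  define B :: "real^('b \<times> 'd)^('n \<times> 'd)" where "B = B_mat \<omega> src dst l"
  define v where "v = block l (x (Suc t)) + \<mu> *\<^sub>R block \<omega> (y t)"
  define p where "p = prox \<mu> g v"
  have z: "z (Suc t) = embed \<omega> p"
    and y: "y (Suc t) = y t + (1 / \<mu>) *\<^sub>R (transpose B *v x (Suc t) - z (Suc t))"
    using iter unfolding DN_ADMM_def Let_def B_def p_def v_def by blast+
  obtain p' where zs: "zs = embed \<omega> p'" and sub': "block \<omega> ys \<in> subdifferential g p'"
    and xs: "transpose B *v xs = zs"
    using opt unfolding KKT_def B_def by auto
  have "block \<omega> (y (Suc t)) = block \<omega> (y t) + (1 / \<mu>) *\<^sub>R (block l (x (Suc t)) - p)"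
  proof -
    have "block \<omega> (y (Suc t)) = block \<omega> (y t)
        + (1 / \<mu>) *\<^sub>R (block \<omega> (transpose B *v x (Suc t)) - block \<omega> (z (Suc t)))"
      unfolding y by (simp add: block_def vec_eq_iff del: transpose_matrix_vector)
    then show ?thesis unfolding z block_embed B_def block_transpose_B_mat by simp
  qed
  also have "\<dots> = (1 / \<mu>) *\<^sub>R (v - p)" using \<mu> by (simp add: v_def algebra_simps)
  finally have sub: "block \<omega> (y (Suc t)) \<in> subdifferential g p"
    unfolding p_def using prox_subgradient[OF g \<mu>] by simp
  have "0 \<le> (block \<omega> (y (Suc t)) - block \<omega> ys) \<bullet> (p - p')"
    by (rule subdifferential_monotone[OF g(1) sub sub'])
  also have "\<dots> = (y (Suc t) - ys) \<bullet> (z (Suc t) - zs)"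
    unfolding z zs embed_diff[symmetric] inner_embed block_diff ..
  finally have mono: "0 \<le> (y (Suc t) - ys) \<bullet> (z (Suc t) - zs)" .
  have "transpose B *v (x (Suc t) - xs) = \<mu> *\<^sub>R (y (Suc t) - y t) + (z (Suc t) - zs)"
    using \<mu> unfolding matrix_vector_mult_diff_distrib xs by (simp add: y)
  moreover have "(B *v (y (Suc t) - ys)) \<bullet> (x (Suc t) - xs)
      = (y (Suc t) - ys) \<bullet> (transpose B *v (x (Suc t) - xs))"
    by (subst (1 2) inner_commute) (rule inner_matrix_transpose)
  ultimately show ?thesis using mono unfolding B_def[symmetric] by (simp add: inner_add_right)
qed

theorem theorem1:
  fixes E :: "'n::finite set set"
    and \<omega> :: "'b::finite" and src dst :: "'b \<Rightarrow> 'n"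
    and l :: 'n
    and f :: "'n \<Rightarrow> real^'d::finite \<Rightarrow> real"
    and g :: "real^'d \<Rightarrow> ereal"
    and m\<^sub>f M\<^sub>f \<mu> \<epsilon> \<beta> \<eta> \<zeta> \<gamma> lmin \<delta> :: real
    and n K :: nat
    and x :: "nat \<Rightarrow> real^('n \<times> 'd)"
    and z y :: "nat \<Rightarrow> real^('b \<times> 'd)"
    and xs :: "real^('n \<times> 'd)"
    and zs ys :: "real^('b \<times> 'd)"
  assumes graph: "simple_graph E" "connected_graph E" "edge_numbering E \<omega> src dst"
    and n: "n = CARD('n)"
    and f_diff: "\<And>i. twice_differentiable (f i)"
    and f_hess: "\<And>i \<xi>. mat m\<^sub>f \<preceq> hessian (f i) \<xi> \<and> hessian (f i) \<xi> \<preceq> mat M\<^sub>f"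
    and mM: "0 < m\<^sub>f" "m\<^sub>f \<le> M\<^sub>f"
    and g: "proper g" "closed_fun g" "convex_fun g"
    and par: "\<mu> > 0" "\<epsilon> > 0"
    and iter: "DN_ADMM K \<mu> \<epsilon> (sep_sum f) g \<omega> src dst l x z y" "y 0 = 0"
    and lam: "lmin = least_pos_eigenvalue
      (transpose (B_mat \<omega> src dst l) ** (B_mat \<omega> src dst l :: real^('b \<times> 'd)^('n \<times> 'd)))"
    and gam: "\<gamma> = 2 * M\<^sub>f + 1 / \<mu>
      + (M\<^sub>f + \<epsilon> + (1 + 2 * (real n - 1)) / \<mu>)
        * ((2 * (real n - 1)) / (\<mu> * (m\<^sub>f + \<epsilon>) + 2 * (real n - 1))) ^ (K + 1)"
    and eps: "\<epsilon> > (2 * M\<^sub>f + (m\<^sub>f + 2 * M\<^sub>f * (real n - 1)) / (\<mu> * m\<^sub>f))\<^sup>2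
      * ((m\<^sub>f + M\<^sub>f) / (2 * m\<^sub>f * M\<^sub>f))"
    and betc: "\<beta> > 1" "\<eta> > 1"
      "\<zeta> \<in> {(m\<^sub>f + M\<^sub>f) / (2 * m\<^sub>f * M\<^sub>f) <..< \<epsilon> / \<gamma>\<^sup>2}"
    and opt: "KKT (sep_sum f) g \<omega> (B_mat \<omega> src dst l) xs zs ys"
      "ys \<in> span (columns (transpose (B_mat \<omega> src dst l :: real^('b \<times> 'd)^('n \<times> 'd))))"
    and del: "\<delta> = Min {2 * m\<^sub>f * M\<^sub>f / (\<epsilon> * (m\<^sub>f + M\<^sub>f)) - 1 / (\<epsilon> * \<zeta>),
      (\<epsilon> - \<zeta> * \<gamma>\<^sup>2) * lmin * (\<beta> - 1) * (\<eta> - 1)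
        / (\<mu> * \<beta> * (\<epsilon>\<^sup>2 * (\<eta> - 1) + \<eta> * \<gamma>\<^sup>2 * (\<beta> - 1))),
      2 * lmin / ((m\<^sub>f + M\<^sub>f) * \<mu> * \<beta> * \<eta>)}"
  shows "\<delta> > 0 \<and> (\<forall>t.
    sqnorm_wrt (weight_mat \<epsilon> \<mu>) (stack (x (Suc t)) (y (Suc t)) - stack xs ys)
      \<le> 1 / (1 + \<delta>) * sqnorm_wrt (weight_mat \<epsilon> \<mu>) (stack (x t) (y t) - stack xs ys))"
proof -
  define F where "F = sep_sum f"
  define B :: "real^('b \<times> 'd)^('n \<times> 'd)" where "B = B_mat \<omega> src dst l"
  define q where "q = real n - 1"
  have F: "twice_differentiable F" "\<And>\<xi>. mat m\<^sub>f \<preceq> hessian F \<xi> \<and> hessian F \<xi> \<preceq> mat M\<^sub>f"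
    unfolding F_def by (intro sep_sum_calculus(1) sep_sum_hessian_bounds f_diff f_hess)+
  have q: "0 \<le> q" by (simp add: q_def n Suc_leI)
  have \<gamma>: "0 < \<gamma>"
    unfolding gam q_def[symmetric] using mM par q
    by (intro add_pos_nonneg mult_nonneg_nonneg zero_le_power divide_nonneg_nonneg add_nonneg_nonneg) auto
  have M: "0 < M\<^sub>f" using mM by simp
  have "0 < (m\<^sub>f + M\<^sub>f) / (2 * m\<^sub>f * M\<^sub>f)" using mM M by simp
  then have \<zeta>: "0 < \<zeta>" "(m\<^sub>f + M\<^sub>f) / (2 * m\<^sub>f * M\<^sub>f) < \<zeta>" "\<zeta> * \<gamma>\<^sup>2 < \<epsilon>"
    using betc(3) \<gamma> by (auto simp: field_simps)
  have lmin: "0 < lmin" unfolding lam by (rule least_pos_eigenvalue_gram(1)[OF B_mat_nonzero])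
  have \<delta>_le: "\<delta> \<le> 2 * m\<^sub>f * M\<^sub>f / (\<epsilon> * (m\<^sub>f + M\<^sub>f)) - 1 / (\<epsilon> * \<zeta>)"
    "\<delta> \<le> (\<epsilon> - \<zeta> * \<gamma>\<^sup>2) * lmin * (\<beta> - 1) * (\<eta> - 1)
        / (\<mu> * \<beta> * (\<epsilon>\<^sup>2 * (\<eta> - 1) + \<eta> * \<gamma>\<^sup>2 * (\<beta> - 1)))"
    "\<delta> \<le> 2 * lmin / ((m\<^sub>f + M\<^sub>f) * \<mu> * \<beta> * \<eta>)"
    by (simp_all add: del)
  have \<delta>: "0 < \<delta>"
  proof -
    have "1 / \<zeta> < 2 * m\<^sub>f * M\<^sub>f / (m\<^sub>f + M\<^sub>f)" using \<zeta> mM M by (simp add: field_simps)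
    then have "1 / \<epsilon> * (1 / \<zeta>) < 1 / \<epsilon> * (2 * m\<^sub>f * M\<^sub>f / (m\<^sub>f + M\<^sub>f))"
      using par by (intro mult_strict_left_mono) auto
    moreover have "0 < \<epsilon>\<^sup>2 * (\<eta> - 1) + \<eta> * \<gamma>\<^sup>2 * (\<beta> - 1)"
      using par betc \<gamma> by (intro add_pos_pos mult_pos_pos) auto
    ultimately show ?thesis
      unfolding del using lmin par betc \<zeta> mM M by simp
  qed
  have "sqnorm_wrt (weight_mat \<epsilon> \<mu>) (stack (x (Suc t)) (y (Suc t)) - stack xs ys)
      \<le> 1 / (1 + \<delta>) * sqnorm_wrt (weight_mat \<epsilon> \<mu>) (stack (x t) (y t) - stack xs ys)" for t
  proof -
    define u where "u = gradient F (x (Suc t)) - gradient F xs"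
    define w where "w = B *v (y (Suc t) - ys)"
    define s where "s = x (Suc t) - x t"
    \<comment> \<open>The optimality condition at \<open>xs\<close> and \<open>ys\<close> turns this into the residual at the new iterate.\<close>
    define e where "e = - (u + w + \<epsilon> *\<^sub>R s)"
    have "gradient F xs + B *v ys = 0" using opt(1) unfolding KKT_def F_def B_def by blast
    then have e: "e = - (gradient F (x (Suc t)) + B *v y (Suc t) + \<epsilon> *\<^sub>R s)"
      by (simp add: e_def u_def w_def matrix_vector_mult_diff_distrib algebra_simps
          eq_neg_iff_add_eq_0)
    have err: "norm e \<le> \<gamma> * norm s"
      unfolding e norm_minus_cancel gam n B_def s_def
      by (rule DN_ADMM_primal_residual[OF graph(1,3) F g mM(1) par iter(1)[folded F_def]])
    have span: "y (Suc t) - ys \<in> span (columns (transpose B))"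
      unfolding B_def by (intro span_diff opt(2) DN_ADMM_dual_range[OF graph(1,3) iter])
    have "(1 + \<delta>) * (\<epsilon> * (norm (x (Suc t) - xs))\<^sup>2 + \<mu> * (norm (y (Suc t) - ys))\<^sup>2)
      \<le> \<epsilon> * (norm (x (Suc t) - xs - s))\<^sup>2 + \<mu> * (norm (y (Suc t) - ys - (y (Suc t) - y t)))\<^sup>2"
    proof (rule inexact_step_contraction[where e = e and u = u and w = w])
      show "u + w + \<epsilon> *\<^sub>R s + e = 0" by (simp add: e_def)
      show "m\<^sub>f * M\<^sub>f * (norm (x (Suc t) - xs))\<^sup>2 + (norm u)\<^sup>2 \<le> (m\<^sub>f + M\<^sub>f) * (u \<bullet> (x (Suc t) - xs))"
        unfolding u_def by (rule gradient_cocoercive[OF F])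
      show "\<mu> * ((y (Suc t) - ys) \<bullet> (y (Suc t) - y t)) \<le> w \<bullet> (x (Suc t) - xs)"
        unfolding w_def B_def by (rule DN_ADMM_dual_step[OF g par(1) iter(1) opt(1)])
      show "lmin * (norm (y (Suc t) - ys))\<^sup>2 \<le> (norm w)\<^sup>2"
        using least_pos_eigenvalue_gram(2)[OF span] by (simp add: lam B_def w_def power2_norm_eq_inner)
    qed (use err mM M par \<zeta> lmin betc \<delta> \<delta>_le in auto)
    then show ?thesis
      unfolding sqnorm_wrt_weight_stack using \<delta> by (simp add: s_def pos_le_divide_eq mult.commute)
  qed
  with \<delta> show ?thesis by blast
qed

end
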